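(* Let $k\ge 1$ be an integer, let $1<\alpha<2$, and let $m$ be a real number with $0\le m<k$, $m\notin\mathbb N$. The solution of Problem A is unique: if $u$ is a solution of Problem A with zero initial data $\varphi\equiv 0$ and $\psi\equiv 0$ (and the homogeneous boundary conditions of Problem A), then $u(x,y)\equiv 0$ in $D$.
   Context: $\mathbb N=\{1,2,\dots\}$. Let $D_x=\{x:0<x<1\}$, $D_y=\{y:0<y<1\}$, $D=D_x\times D_y$. The Riemann–Liouville fractional derivative of order $\alpha\in(1,2)$ in $x$ is $$D_{0x}^{\alpha}u(x,y)=\frac{1}{\Gamma(2-\alpha)}\frac{d^2}{dx^2}\int_0^x\frac{u(\tau,y)\,d\tau}{(x-\tau)^{\alpha-1}}.$$ Problem A (with data $\varphi,\psi:[0,1]\to\mathbb R$): find a function $u(x,y)$ satisfying the equation $$(-1)^{k+1}D_{0x}^{\alpha}u(x,y)-y^m\frac{\partial^{2k}u(x,y)}{\partial y^{2k}}=0\quad\text{in } D,$$ the regularity conditions $$D_{0x}^\alpha u\in C(D_x\times\overline{D}_y),\qquad x^{2-\alpha}u(x,y)\in C^1(\overline D),\qquad \frac{\partial^{2k}u}{\partial y^{2k}}\in C(D_x\times\overline D_y),$$ (where $x^{2-\alpha}u\in C^1(\overline D)$ means that it extends to such a function), the boundary conditions $$\frac{\partial^{s}u(x,0)}{\partial y^{s}}=\frac{\partial^{s}u(x,1)}{\partial y^{s}}=0,\qquad 0<x\le 1,\quad s=0,1,\dots,k-1,$$ and the initial conditions, for $y\in[0,1]$, $$\lim_{x\to0+}x^{2-\alpha}u(x,y)=\psi(y),\qquad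 \lim_{x\to0+}\frac{\partial}{\partial x}\big(x^{2-\alpha}u(x,y)\big)=\varphi(y).$$ *)

theory Defs
  imports "HOL-Analysis.Analysis"
begin

text \<open>\<open>has_nth_deriv n f S x d\<close>: the \<open>n\<close>-th derivative of \<open>f\<close> relative to \<open>S\<close> exists at \<open>x\<close> and
  equals \<open>d\<close>; at an endpoint of an interval \<open>S\<close> this is the one-sided derivative. As usual, the
  derivative of order \<open>n\<close> is required to exist on a neighbourhood of \<open>x\<close> in \<open>S\<close> (including \<open>x\<close>)
  for the one of order \<open>n + 1\<close> to exist at \<open>x\<close>.\<close>

fun has_nth_deriv :: "nat \<Rightarrow> (real \<Rightarrow> real) \<Rightarrow> real set \<Rightarrow> real \<Rightarrow> real \<Rightarrow> bool" where
  "has_nth_deriv 0 f S x d \<longleftrightarrow> f x = d"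
| "has_nth_deriv (Suc n) f S x d \<longleftrightarrow>
     (\<exists>g. (\<forall>\<^sub>F z in nhds x. z \<in> S \<longrightarrow> has_nth_deriv n f S z (g z)) \<and>
          (g has_real_derivative d) (at x within S))"

text \<open>Riemann--Liouville derivative of order \<open>\<alpha> \<in> (1,2)\<close> with base point \<open>0\<close>. The value of the
  integrand at \<open>\<tau> = 0\<close> and \<open>\<tau> = x\<close> does not matter for the integral.\<close>

definition has_RL_deriv :: "real \<Rightarrow> (real \<Rightarrow> real) \<Rightarrow> real \<Rightarrow> real \<Rightarrow> bool" where
  "has_RL_deriv \<alpha> f x d \<longleftrightarrow>
     (\<exists>d2. has_nth_deriv 2 (\<lambda>t. integral {0..t} (\<lambda>\<tau>. f \<tau> / (t - \<tau>) powr (\<alpha> - 1))) UNIV x d2 \<and>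
           d = 1 / Gamma (2 - \<alpha>) * d2)"

definition C1_closed_square :: "(real \<Rightarrow> real \<Rightarrow> real) \<Rightarrow> bool" where
  "C1_closed_square w \<longleftrightarrow>
     continuous_on ({0..1} \<times> {0..1}) (\<lambda>(x, y). w x y) \<and>
     (\<exists>wx wy.
        continuous_on ({0..1} \<times> {0..1}) (\<lambda>(x, y). wx x y) \<and>
        continuous_on ({0..1} \<times> {0..1}) (\<lambda>(x, y). wy x y) \<and>
        (\<forall>x\<in>{0..1}. \<forall>y\<in>{0..1}.
           ((\<lambda>t. w t y) has_real_derivative wx x y) (at x within {0..1}) \<and>
           ((\<lambda>t. w x t) has_real_derivative wy x y) (at y within {0..1})))"

text \<open>A solution \<open>u x y\<close> is a function on \<open>(0,1] \<times> [0,1]\<close>; no value of \<open>u\<close> off this set matters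
  (in particular at \<open>x = 0\<close>, where \<open>x powr (2 - \<alpha>) * u x y\<close> is extended by \<open>w\<close>).
  \<open>Du\<close> and \<open>V\<close> are the Riemann--Liouville derivative in \<open>x\<close> and the \<open>2k\<close>-th derivative in \<open>y\<close>.\<close>

definition solves_problem_A ::
  "nat \<Rightarrow> real \<Rightarrow> real \<Rightarrow> (real \<Rightarrow> real) \<Rightarrow> (real \<Rightarrow> real) \<Rightarrow> (real \<Rightarrow> real \<Rightarrow> real) \<Rightarrow> bool" where
  "solves_problem_A k \<alpha> m \<phi> \<psi> u \<longleftrightarrow>
     (\<exists>Du V.
        (\<forall>x\<in>{0<..<1}. \<forall>y\<in>{0..1}. has_RL_deriv \<alpha> (\<lambda>t. u t y) x (Du x y)) \<and>
        continuous_on ({0<..<1} \<times> {0..1}) (\<lambda>(x, y). Du x y) \<and>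
        (\<forall>x\<in>{0<..<1}. \<forall>y\<in>{0..1}. has_nth_deriv (2 * k) (u x) {0..1} y (V x y)) \<and>
        continuous_on ({0<..<1} \<times> {0..1}) (\<lambda>(x, y). V x y) \<and>
        (\<forall>x\<in>{0<..<1}. \<forall>y\<in>{0<..<1}. (- 1) ^ (k + 1) * Du x y - y powr m * V x y = 0)) \<and>
     (\<exists>w. C1_closed_square w \<and>
        (\<forall>x\<in>{0<..1}. \<forall>y\<in>{0..1}. w x y = x powr (2 - \<alpha>) * u x y)) \<and>
     (\<forall>x\<in>{0<..1}. \<forall>s<k.
        has_nth_deriv s (u x) {0..1} 0 0 \<and> has_nth_deriv s (u x) {0..1} 1 0) \<and>
     (\<forall>y\<in>{0..1}.
        ((\<lambda>x. x powr (2 - \<alpha>) * u x y) \<longlongrightarrow> \<psi> y) (at_right 0) \<and>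
        ((\<lambda>x. deriv (\<lambda>t. t powr (2 - \<alpha>) * u t y) x) \<longlongrightarrow> \<phi> y) (at_right 0))"

end

theory Submission
  imports Defs "HOL-Computational_Algebra.Polynomial"
begin

text \<open>Let \<open>u\<close> be the difference of two solutions. The operator \<open>L = (- 1)^k y^m (d/dy)^(2k)\<close> with the
  boundary conditions \<open>e^(s)(0) = e^(s)(1) = 0\<close> for \<open>s < k\<close> is symmetric for the inner product
  \<open>\<langle>f, g\<rangle> = \<integral> y^(-m) f g dy\<close>, and \<open>u\<close> satisfies \<open>D^\<alpha> u = - L u\<close>. Fix \<open>x0\<close>, put \<open>e_0 = u(x0, \<cdot>)\<close> and
  solve \<open>L e_(n+1) = e_n\<close>. The moments \<open>p_n(x) = \<langle>u(x, \<cdot>), e_n\<rangle>\<close> satisfy \<open>D^\<alpha> p_(n+1) = - p_n\<close>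
  with zero initial data, and inverting the Abel kernel gives \<open>\<bar>p_n(x)\<bar> \<le> A C^n x^n / n!\<close>.
  By symmetry \<open>\<langle>e_i, e_j\<rangle> = p_(i+j)(x0)\<close>, so the sequence \<open>\<langle>e_n, e_n\<rangle> = p_(2n)(x0)\<close>, which is log-convex
  by Cauchy-Schwarz, decays faster than any geometric sequence. Hence \<open>\<langle>e_1, e_1\<rangle> = 0\<close>, so \<open>e_1 = 0\<close>
  and \<open>e_0 = L e_1 = 0\<close>.\<close>

section \<open>Functions with clamped boundary values\<close>

text \<open>No eigenfunction expansion is used: completeness for the degenerate operator is replaced
  by the decay of one sequence of numbers. The iterates go through the inverse of \<open>L\<close>
  because \<open>u x0\<close> has only \<open>2k\<close> derivatives, so \<open>L\<close> could not
  be applied repeatedly, whereas \<open>L e_(n+1) = e_n\<close> can be solved at every stage: its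
  right-hand side \<open>y powr (- m) * e_n\<close> is continuous up to \<open>y = 0\<close>, as
  \<open>e_n\<close> vanishes there to order \<open>k > m\<close>. In \<open>x\<close> the equation
  is available only for \<open>0 < x < 1\<close>, so integrating it twice leaves an unknown affine
  term. The two initial conditions remove it: they give \<open>p_n(x) = o(x^(\<alpha> - 1))\<close>,
  hence an Abel integral that is \<open>o(x)\<close>. Decay then contradicts log-convexity because a
  positive log-convex sequence is bounded below by a geometric one. The sequence 1, 0, 0, ... passes
  both tests, which is why the argument reaches \<open>e_1\<close> before
  \<open>e_0\<close>.\<close>

text \<open>\<open>D j\<close> is the \<open>j\<close>-th derivative of \<open>D 0\<close> for \<open>j \<le> 2k\<close>; for larger \<open>j\<close> it is irrelevant.\<close>

definition clamped :: "nat \<Rightarrow> (nat \<Rightarrow> real \<Rightarrow> real) \<Rightarrow> bool" where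
  "clamped k D \<longleftrightarrow>
     (\<forall>j<2 * k. \<forall>y\<in>{0..1}. (D j has_real_derivative D (Suc j) y) (at y within {0..1})) \<and>
     continuous_on {0..1} (D (2 * k)) \<and>
     (\<forall>j<k. D j 0 = 0 \<and> D j 1 = 0)"

lemma clamped_continuous:
  assumes "clamped k D" "j \<le> 2 * k"
  shows "continuous_on {0..1} (D j)"
proof (cases "j = 2 * k")
  case True
  then show ?thesis using assms by (simp add: clamped_def)
next
  case False
  then have "\<forall>y\<in>{0..1}. (D j has_real_derivative D (Suc j) y) (at y within {0..1})"
    using assms by (simp add: clamped_def)
  then show ?thesis
    by (meson DERIV_continuous_on)
qed

text \<open>The concomitant \<open>B\<close>, an alternating sum of products of derivatives, has a
  telescoping derivative; the sign of its last term is \<open>+\<close> because the order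
  \<open>2 * k\<close> is even. In each product the orders \<open>2 * k - 1 - j\<close> and
  \<open>j\<close> add up to \<open>2 * k - 1\<close>, so one of them is below \<open>k\<close> and
  \<open>B\<close> vanishes at both ends.\<close>

lemma clamped_by_parts:
  assumes D: "clamped k D" and E: "clamped k E"
  shows "integral {0..1} (\<lambda>y. D (2 * k) y * E 0 y) = integral {0..1} (\<lambda>y. D 0 y * E (2 * k) y)"
proof -
  define B where "B y = (\<Sum>j<2 * k. (- 1) ^ j * (D (2 * k - 1 - j) y * E j y))" for y :: real
  have der: "(B has_real_derivative (D (2 * k) y * E 0 y - D 0 y * E (2 * k) y)) (at y within {0..1})"
    if y: "y \<in> {0..1}" for y
  proof -
    have 1: "(B has_real_derivative (\<Sum>j<2 * k. (- 1) ^ j *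
        (D (2 * k - 1 - j) y * E (Suc j) y + D (2 * k - j) y * E j y))) (at y within {0..1})"
      unfolding B_def
    proof (rule DERIV_sum)
      fix j assume "j \<in> {..<2 * k}"
      then have j: "j < 2 * k" by simp
      then have eq: "Suc (2 * k - 1 - j) = 2 * k - j" by simp
      have "(D (2 * k - 1 - j) has_real_derivative D (2 * k - j) y) (at y within {0..1})"
        using D y j unfolding clamped_def eq[symmetric] by auto
      moreover have "(E j has_real_derivative E (Suc j) y) (at y within {0..1})"
        using E y j unfolding clamped_def by auto
      ultimately show "((\<lambda>y. (- 1) ^ j * (D (2 * k - 1 - j) y * E j y)) has_real_derivative
          (- 1) ^ j * (D (2 * k - 1 - j) y * E (Suc j) y + D (2 * k - j) y * E j y)) (at y within {0..1})"
        by (auto intro!: derivative_eq_intros)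
    qed
    define t where "t j = (- 1) ^ j * (D (2 * k - j) y * E j y)" for j
    have "(\<Sum>j<2 * k. (- 1) ^ j * (D (2 * k - 1 - j) y * E (Suc j) y + D (2 * k - j) y * E j y))
        = (\<Sum>j<2 * k. t j - t (Suc j))"
      by (rule sum.cong) (auto simp: t_def algebra_simps)
    also have "\<dots> = t 0 - t (2 * k)"
      by (rule sum_lessThan_telescope')
    finally show ?thesis using 1 by (simp add: t_def)
  qed
  have Bz: "B y = 0" if "y = 0 \<or> y = 1" for y
    unfolding B_def
  proof (rule sum.neutral, rule ballI)
    fix j assume "j \<in> {..<2 * k}"
    then have "j < k \<or> 2 * k - 1 - j < k" by auto
    then show "(- 1) ^ j * (D (2 * k - 1 - j) y * E j y) = 0"
      using D E that unfolding clamped_def by auto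
  qed
  have "((\<lambda>y. D (2 * k) y * E 0 y - D 0 y * E (2 * k) y) has_integral (B 1 - B 0)) {0..1}"
    by (rule fundamental_theorem_of_calculus)
       (auto intro: der simp flip: has_real_derivative_iff_has_vector_derivative)
  then have "integral {0..1} (\<lambda>y. D (2 * k) y * E 0 y - D 0 y * E (2 * k) y) = 0"
    using Bz[of 0] Bz[of 1] by (simp add: integral_unique)
  moreover have "(\<lambda>y. D (2 * k) y * E 0 y) integrable_on {0..1}"
      "(\<lambda>y. D 0 y * E (2 * k) y) integrable_on {0..1}"
    by (intro integrable_continuous_real continuous_intros clamped_continuous[OF D]
        clamped_continuous[OF E]; simp)+
  ultimately show ?thesis by (simp add: integral_diff)
qed

section \<open>Hermite interpolation and the inverse of the \<open>2k\<close>-th derivative under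
  clamped conditions\<close>

text \<open>One differentiation turns \<open>p * (X - a)^(n + 1)\<close> into
  \<open>((n + 1) p + (X - a) p') * (X - a)^n\<close>, and the new cofactor has the value
  \<open>(n + 1) * p(a)\<close> at \<open>a\<close>; iterating collects the factorial.\<close>

lemma poly_higher_pderiv_root_power:
  fixes p :: "real poly"
  assumes "j \<le> n"
  shows "poly ((pderiv ^^ j) (p * [:- a, 1:] ^ n)) a = (if j = n then fact n * poly p a else 0)"
  using assms
proof (induction n arbitrary: p j)
  case 0
  then show ?case by simp
next
  case (Suc n)
  show ?case
  proof (cases j)
    case 0
    then show ?thesis by simp
  next
    case (Suc i)
    have "pderiv (p * [:- a, 1:] ^ Suc n)
        = (smult (of_nat (Suc n)) p + [:- a, 1:] * pderiv p) * [:- a, 1:] ^ n"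
      by (simp only: pderiv_mult pderiv_power_Suc) (simp add: pderiv_pCons algebra_simps)
    then have "(pderiv ^^ j) (p * [:- a, 1:] ^ Suc n)
        = (pderiv ^^ i) ((smult (of_nat (Suc n)) p + [:- a, 1:] * pderiv p) * [:- a, 1:] ^ n)"
      using Suc by (simp add: funpow_Suc_right del: funpow.simps power_Suc)
    then show ?thesis
      using Suc.IH[of i "smult (of_nat (Suc n)) p + [:- a, 1:] * pderiv p"] Suc.prems Suc
      by (simp del: power_Suc)
  qed
qed

lemma higher_pderiv_add: "(pderiv ^^ j) (p + q) = (pderiv ^^ j) p + (pderiv ^^ j) (q :: real poly)"
  by (induction j) (simp_all add: pderiv_add)

lemma degree_higher_pderiv: "degree ((pderiv ^^ j) (p :: real poly)) = degree p - j"
  by (induction j) (simp_all add: degree_pderiv)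

lemma degree_root_powers: "degree ([:0, 1:] ^ k * [:- 1, 1:] ^ n :: real poly) = k + n"
  by (simp add: degree_mult_eq degree_power_eq)

text \<open>Induction on \<open>n\<close>: a multiple of \<open>X^k (X - 1)^n\<close> adjusts the \<open>n\<close>-th derivative at \<open>1\<close> without
  changing the lower ones.\<close>

lemma hermite_at_1:
  fixes a :: "nat \<Rightarrow> real"
  assumes "0 < k"
  shows "\<exists>q. degree q < k + n \<and> (\<forall>j<k. poly ((pderiv ^^ j) q) 0 = 0) \<and>
             (\<forall>j<n. poly ((pderiv ^^ j) q) 1 = a j)"
proof (induction n)
  case 0
  have "(pderiv ^^ j) (0 :: real poly) = 0" for j by (induction j) simp_all
  then show ?case using assms by (intro exI[of _ 0]) simp
next
  case (Suc n)
  then obtain q where q: "degree q < k + n" "\<forall>j<k. poly ((pderiv ^^ j) q) 0 = 0"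
      "\<forall>j<n. poly ((pderiv ^^ j) q) 1 = a j" by blast
  define r :: "real poly" where "r = [:0, 1:] ^ k * [:- 1, 1:] ^ n"
  \<comment> \<open>The \<open>n\<close>-th derivative of \<open>r\<close> at \<open>1\<close> is
    \<open>n!\<close>, since the cofactor \<open>X^k\<close> equals 1 there; hence the
    division.\<close>
  define c where "c = (a n - poly ((pderiv ^^ n) q) 1) / fact n"
  have r1: "poly ((pderiv ^^ j) (smult c r)) 1 = (if j = n then fact n * c else 0)" if "j \<le> n" for j
    using poly_higher_pderiv_root_power[OF that, of "smult c ([:0, 1:] ^ k)" 1]
    by (simp add: r_def)
  have "r = [:- 1, 1:] ^ n * [:- 0, 1:] ^ k" by (simp add: r_def)
  then have r0: "poly ((pderiv ^^ j) (smult c r)) 0 = 0" if "j < k" for j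
    using poly_higher_pderiv_root_power[of j k "smult c ([:- 1, 1:] ^ n)" 0] that
    by simp
  have "degree (q + smult c r) < k + Suc n"
    using q(1) degree_root_powers[of k n] degree_smult_le[of c r]
    unfolding r_def[symmetric] by (intro degree_add_less) auto
  then show ?case
    using q r0 r1
    by (intro exI[of _ "q + smult c r"]) (auto simp: higher_pderiv_add less_Suc_eq c_def)
qed

text \<open>Integrating \<open>g\<close> from 0, \<open>2 * k\<close> times, gives the right top
  derivative and the conditions at 0. A polynomial of degree below \<open>2 * k\<close> corrects the
  values at 1: it vanishes to order \<open>k\<close> at 0 and is killed by \<open>2 * k\<close>
  derivatives.\<close>

lemma clamped_exists:
  assumes k: "0 < k" and g: "continuous_on {0..1} g"
  shows "\<exists>D. clamped k D \<and> (\<forall>y\<in>{0..1}. D (2 * k) y = g y)"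
proof -
  define I where "I f y = integral {0..y} f" for f :: "real \<Rightarrow> real" and y
  \<comment> \<open>Indexed by the number of derivatives taken, so that \<open>h (2 * k)\<close> is
    \<open>g\<close> and each \<open>h j\<close> with \<open>j < 2 * k\<close> is an antiderivative
    of \<open>h (Suc j)\<close>.\<close>
  define h where "h j = (I ^^ (2 * k - j)) g" for j
  have hI: "h j = I (h (Suc j))" if "j < 2 * k" for j
  proof -
    have "2 * k - j = Suc (2 * k - Suc j)" using that by simp
    then show ?thesis unfolding h_def by (metis funpow.simps(2) comp_apply)
  qed
  have Id: "(I f has_real_derivative f y) (at y within {0..1})"
    if "continuous_on {0..1} f" "y \<in> {0..1}" for f y
    using integral_has_vector_derivative[OF that]
    by (simp add: I_def[abs_def] has_real_derivative_iff_has_vector_derivative)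
  then have Ic: "continuous_on {0..1} (I f)" if "continuous_on {0..1} f" for f
    using that by (meson DERIV_continuous_on)
  have hc: "continuous_on {0..1} (h j)" for j
  proof -
    have "continuous_on {0..1} ((I ^^ n) g)" for n
      by (induction n) (simp_all add: g Ic)
    then show ?thesis by (simp add: h_def)
  qed
  obtain q where q: "degree q < k + k" "\<forall>j<k. poly ((pderiv ^^ j) q) 0 = 0"
      "\<forall>j<k. poly ((pderiv ^^ j) q) 1 = - h j 1"
    using hermite_at_1[OF k, of k "\<lambda>j. - h j 1"] by blast
  define D where "D j y = h j y + poly ((pderiv ^^ j) q) y" for j y
  have qd: "(pderiv ^^ (2 * k)) q = 0"
  proof -
    obtain i where i: "2 * k = Suc i" "degree q \<le> i" using q(1) k by (cases "2 * k") auto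
    then have "degree ((pderiv ^^ i) q) = 0" by (simp add: degree_higher_pderiv)
    then show ?thesis using i by (simp add: pderiv_eq_0_iff)
  qed
  have "clamped k D"
    unfolding clamped_def
  proof (intro conjI allI impI ballI)
    fix j y assume j: "j < 2 * k" and y: "y \<in> {0..1::real}"
    show "(D j has_real_derivative D (Suc j) y) (at y within {0..1})"
      unfolding D_def[abs_def] hI[OF j]
      by (auto intro!: derivative_eq_intros Id hc y)
  next
    show "continuous_on {0..1} (D (2 * k))"
      unfolding D_def by (intro continuous_intros hc)
  next
    fix j assume j: "j < k"
    have "h j 0 = 0" using j by (subst hI) (auto simp: I_def)
    then show "D j 0 = 0" "D j 1 = 0" using q j by (simp_all add: D_def)
  qed
  moreover have "D (2 * k) y = g y" for y by (simp add: D_def qd h_def)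
  ultimately show ?thesis by blast
qed

section \<open>The weight at the degenerate edge \<open>y = 0\<close>\<close>

text \<open>Starting from a bound for the \<open>k\<close>-th derivative, each step down in order
  gains one factor \<open>y\<close> by the mean value inequality on \<open>[0, y]\<close>, since the
  lower derivatives vanish at 0.\<close>

lemma clamped_bound_at_0:
  assumes D: "clamped k D"
  obtains M where "\<And>y. y \<in> {0..1} \<Longrightarrow> \<bar>D 0 y\<bar> \<le> M * y ^ k"
proof -
  have "compact (D k ` {0..1})"
    by (intro compact_continuous_image clamped_continuous[OF D]) auto
  then obtain M where M: "\<And>y. y \<in> {0..1} \<Longrightarrow> \<bar>D k y\<bar> \<le> M"
    by (metis bounded_iff compact_imp_bounded image_eqI real_norm_def)
  have "\<forall>y\<in>{0..1}. \<bar>D (k - n) y\<bar> \<le> M * y ^ n" if "n \<le> k" for n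
    using that
  proof (induction n)
    case 0
    then show ?case using M by simp
  next
    case (Suc n)
    define j where "j = k - Suc n"
    have j: "j < k" "Suc j = k - n" using Suc.prems by (auto simp: j_def)
    show ?case
    proof
      fix y :: real assume y: "y \<in> {0..1}"
      have "norm (D j y - D j 0) \<le> (M * y ^ n) * norm (y - 0)"
      proof (rule field_differentiable_bound[of "{0..y}"])
        fix z assume z: "z \<in> {0..y}"
        then have "(D j has_real_derivative D (Suc j) z) (at z within {0..1})"
          using D y z j(1) unfolding clamped_def by simp
        then show "(D j has_field_derivative D (Suc j) z) (at z within {0..y})"
          by (rule DERIV_subset) (use y in auto)
        have "\<bar>D (Suc j) z\<bar> \<le> M * z ^ n" using Suc z y j by auto
        also have "\<dots> \<le> M * y ^ n"
          using z M[of 0] by (intro mult_left_mono power_mono) auto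
        finally show "norm (D (Suc j) z) \<le> M * y ^ n" by simp
      qed (use y in auto)
      then show "\<bar>D (k - Suc n) y\<bar> \<le> M * y ^ Suc n"
        using D j y by (simp add: clamped_def j_def mult_ac)
    qed
  qed
  from this[of k] show ?thesis by (intro that) auto
qed

text \<open>Away from 0 the weight is smooth. At 0 the product is \<open>O(y^(k - m))\<close>, which
  tends to 0 because \<open>m < k\<close>.\<close>

lemma clamped_weight_continuous:
  assumes D: "clamped k D" and m: "m < real k"
  shows "continuous_on {0..1} (\<lambda>y. y powr (- m) * D 0 y)"
proof -
  obtain M where M: "\<And>y. y \<in> {0..1} \<Longrightarrow> \<bar>D 0 y\<bar> \<le> M * y ^ k"
    using clamped_bound_at_0[OF D] by blast
  have c0: "continuous_on {0..1} (D 0)" by (rule clamped_continuous[OF D]) simp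
  have "continuous (at y within {0..1}) (\<lambda>y. y powr (- m) * D 0 y)" if y: "y \<in> {0..1}" for y
  proof (cases "y = 0")
    case False
    have "continuous (at y within {0..1}) (\<lambda>y. y powr (- m))"
      by (rule continuous_at_imp_continuous_within, rule DERIV_isCont, rule has_real_derivative_powr)
        (use False y in auto)
    moreover have "continuous (at y within {0..1}) (D 0)"
      using c0 y by (simp add: continuous_on_eq_continuous_within)
    ultimately show ?thesis by (rule continuous_mult)
  next
    case True
    have "((\<lambda>y. y powr (- m) * D 0 y) \<longlongrightarrow> 0) (at 0 within {0..1})"
    proof (rule Lim_null_comparison)
      show "\<forall>\<^sub>F y in at 0 within {0..1}. norm (y powr (- m) * D 0 y) \<le> M * y powr (real k - m)"
        unfolding eventually_at_filter
      proof (intro always_eventually allI impI)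
        fix y :: real assume "y \<noteq> 0" "y \<in> {0..1}"
        then have y: "0 < y" "y \<le> 1" by auto
        have "norm (y powr (- m) * D 0 y) = y powr (- m) * \<bar>D 0 y\<bar>" by (simp add: abs_mult)
        also have "\<dots> \<le> y powr (- m) * (M * y ^ k)" using M[of y] y by (intro mult_left_mono) auto
        also have "\<dots> = M * y powr (real k - m)"
          using y by (simp add: powr_realpow[symmetric] powr_diff powr_minus field_simps)
        finally show "norm (y powr (- m) * D 0 y) \<le> M * y powr (real k - m)" .
      qed
      have "((\<lambda>y. M * y powr (real k - m)) \<longlongrightarrow> M * 0 powr (real k - m)) (at 0 within {0..1})"
        using m by (intro tendsto_mult tendsto_const tendsto_powr' tendsto_ident_at)
          (auto simp: eventually_at_filter)
      then show "((\<lambda>y. M * y powr (real k - m)) \<longlongrightarrow> 0) (at 0 within {0..1})" by simp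
    qed
    \<comment> \<open>The value at 0 agrees with the limit because
      \<open>0 powr (- m) = 0\<close>.\<close>
    then show ?thesis using True by (simp add: continuous_within)
  qed
  then show ?thesis by (simp add: continuous_on_eq_continuous_within)
qed

section \<open>Iterated one-sided derivatives\<close>

text \<open>Two witnesses for the lower derivative agree near \<open>y\<close> within
  \<open>S\<close> by induction, so they have the same derivative there; it is determined because no
  point of \<open>S\<close> is isolated.\<close>

lemma has_nth_deriv_unique:
  assumes "\<And>z. z \<in> S \<Longrightarrow> at z within S \<noteq> bot" and "y \<in> S"
    and "has_nth_deriv n f S y d" and "has_nth_deriv n f S y d'"
  shows "d = d'"
  using assms(2-)
proof (induction n arbitrary: y d d')
  case 0
  then show ?case by simp
next
  case (Suc n)
  from Suc.prems(2) obtain g where g: "\<forall>\<^sub>F z in nhds y. z \<in> S \<longrightarrow> has_nth_deriv n f S z (g z)"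
      "(g has_real_derivative d) (at y within S)" by auto
  from Suc.prems(3) obtain g' where g': "\<forall>\<^sub>F z in nhds y. z \<in> S \<longrightarrow> has_nth_deriv n f S z (g' z)"
      "(g' has_real_derivative d') (at y within S)" by auto
  from g(1) g'(1) have ev: "\<forall>\<^sub>F z in nhds y. z \<in> S \<longrightarrow> g z = g' z"
    by eventually_elim (use Suc.IH in blast)
  then have "g y = g' y" using Suc.prems(1) eventually_nhds_x_imp_x by fastforce
  moreover have "\<forall>\<^sub>F z in at y within S. g z = g' z"
    using ev by (auto simp: eventually_at_filter elim!: eventually_mono)
  ultimately have "(g' has_real_derivative d) (at y within S)"
    using g(2) has_field_derivative_cong_eventually by blast
  then show ?case using g'(2) assms(1)[OF Suc.prems(1)] has_field_derivative_unique by blast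
qed

lemma has_nth_deriv_SucD:
  assumes "has_nth_deriv (Suc n) f S y d" "y \<in> S"
  shows "\<exists>d'. has_nth_deriv n f S y d'"
proof -
  from assms(1) obtain g where "\<forall>\<^sub>F z in nhds y. z \<in> S \<longrightarrow> has_nth_deriv n f S z (g z)" by auto
  then show ?thesis using assms(2) eventually_nhds_x_imp_x by blast
qed

lemma has_nth_deriv_le:
  assumes "has_nth_deriv n f S y d" "y \<in> S" "j \<le> n"
  shows "\<exists>d'. has_nth_deriv j f S y d'"
  using assms
proof (induction n arbitrary: d)
  case 0
  then show ?case by auto
next
  case (Suc n)
  show ?case
  proof (cases "j = Suc n")
    case True
    then show ?thesis using Suc.prems by blast
  next
    case False
    then show ?thesis using Suc has_nth_deriv_SucD[OF Suc.prems(1,2)] by (metis le_SucE)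
  qed
qed

text \<open>Turns the relation into a function, as the family required by \<open>clamped\<close>
  needs; the value is meaningful only where the derivative exists and is unique.\<close>

definition nth_deriv :: "(real \<Rightarrow> real) \<Rightarrow> real set \<Rightarrow> nat \<Rightarrow> real \<Rightarrow> real" where
  "nth_deriv f S j y = (THE d. has_nth_deriv j f S y d)"

lemma nth_deriv_eq:
  assumes "\<And>z. z \<in> S \<Longrightarrow> at z within S \<noteq> bot" and "y \<in> S" and "has_nth_deriv n f S y d"
  shows "nth_deriv f S n y = d"
  unfolding nth_deriv_def using has_nth_deriv_unique[OF assms(1,2)] assms(3) by blast

text \<open>The witness in \<open>has_nth_deriv\<close> is chosen separately at each point. By
  uniqueness it coincides near \<open>y\<close> with the global function \<open>nth_deriv\<close>,
  which therefore inherits its derivative.\<close>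

lemma nth_deriv_has_derivative:
  assumes S: "\<And>z. z \<in> S \<Longrightarrow> at z within S \<noteq> bot" and y: "y \<in> S"
    and d: "has_nth_deriv n f S y d" and j: "j < n"
  shows "(nth_deriv f S j has_real_derivative nth_deriv f S (Suc j) y) (at y within S)"
proof -
  obtain d' where d': "has_nth_deriv (Suc j) f S y d'"
    using has_nth_deriv_le[OF d y, of "Suc j"] j by auto
  then obtain g where g: "\<forall>\<^sub>F z in nhds y. z \<in> S \<longrightarrow> has_nth_deriv j f S z (g z)"
      "(g has_real_derivative d') (at y within S)" by auto
  from g(1) have ev: "\<forall>\<^sub>F z in nhds y. z \<in> S \<longrightarrow> g z = nth_deriv f S j z"
    by eventually_elim (metis nth_deriv_eq[OF S])
  then have "g y = nth_deriv f S j y" using y eventually_nhds_x_imp_x by fastforce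
  moreover have "\<forall>\<^sub>F z in at y within S. g z = nth_deriv f S j z"
    using ev by (auto simp: eventually_at_filter elim!: eventually_mono)
  ultimately have "(nth_deriv f S j has_real_derivative d') (at y within S)"
    using g(2) has_field_derivative_cong_eventually by blast
  then show ?thesis using nth_deriv_eq[OF S y d'] by simp
qed

lemma has_nth_deriv_diff:
  assumes "has_nth_deriv n f S y d" "has_nth_deriv n f' S y d'"
  shows "has_nth_deriv n (\<lambda>z. f z - f' z) S y (d - d')"
  using assms
proof (induction n arbitrary: y d d')
  case 0
  then show ?case by simp
next
  case (Suc n)
  from Suc.prems(1) obtain g where g: "\<forall>\<^sub>F z in nhds y. z \<in> S \<longrightarrow> has_nth_deriv n f S z (g z)"
      "(g has_real_derivative d) (at y within S)" by auto
  from Suc.prems(2) obtain g' where g': "\<forall>\<^sub>F z in nhds y. z \<in> S \<longrightarrow> has_nth_deriv n f' S z (g' z)"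
      "(g' has_real_derivative d') (at y within S)" by auto
  from g(1) g'(1) have "\<forall>\<^sub>F z in nhds y. z \<in> S \<longrightarrow> has_nth_deriv n (\<lambda>z. f z - f' z) S z (g z - g' z)"
    by eventually_elim (use Suc.IH in blast)
  moreover have "((\<lambda>z. g z - g' z) has_real_derivative (d - d')) (at y within S)"
    using g(2) g'(2) by (rule DERIV_diff)
  ultimately show ?case by auto
qed

lemma has_nth_deriv_cong:
  assumes "has_nth_deriv n f S y d" "\<forall>\<^sub>F z in nhds y. z \<in> S \<longrightarrow> f z = f' z" "y \<in> S"
  shows "has_nth_deriv n f' S y d"
  using assms
proof (induction n arbitrary: y d)
  case 0
  then show ?case using eventually_nhds_x_imp_x by fastforce
next
  case (Suc n)
  from Suc.prems(1) obtain g where g: "\<forall>\<^sub>F z in nhds y. z \<in> S \<longrightarrow> has_nth_deriv n f S z (g z)"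
      "(g has_real_derivative d) (at y within S)" by auto
  \<comment> \<open>Equality near \<open>y\<close> is also equality near every point close to
    \<open>y\<close>, which is the form the induction hypothesis consumes.\<close>
  from Suc.prems(2) have "\<forall>\<^sub>F z in nhds y. \<forall>\<^sub>F z in nhds z. z \<in> S \<longrightarrow> f z = f' z"
    by (simp add: eventually_eventually)
  with g(1) have "\<forall>\<^sub>F z in nhds y. z \<in> S \<longrightarrow> has_nth_deriv n f' S z (g z)"
    by eventually_elim (use Suc.IH in blast)
  then show ?case using g(2) by auto
qed

text \<open>The bridge from the pointwise regularity in Problem A to the derivative families on
  which integration by parts operates.\<close>

lemma has_nth_deriv_clamped:
  assumes V: "\<And>y. y \<in> {0..1} \<Longrightarrow> has_nth_deriv (2 * k) f {0..1} y (V y)"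
    and c: "continuous_on {0..1} V"
    and b: "\<And>s. s < k \<Longrightarrow> has_nth_deriv s f {0..1} 0 0 \<and> has_nth_deriv s f {0..1} 1 0"
  obtains D where "clamped k D" "\<And>y. y \<in> {0..1} \<Longrightarrow> D 0 y = f y"
    "\<And>y. y \<in> {0..1} \<Longrightarrow> D (2 * k) y = V y"
proof
  have S: "at z within {0..1} \<noteq> bot" if "z \<in> {0..1}" for z :: real
    using that by (simp add: trivial_limit_within)
  let ?D = "nth_deriv f {0..1}"
  show 2: "?D (2 * k) y = V y" if "y \<in> {0..1}" for y
    using nth_deriv_eq[OF S] V that by blast
  show "?D 0 y = f y" if "y \<in> {0..1}" for y
    using nth_deriv_eq[OF S, where n = 0] that by simp
  show "clamped k ?D"
    unfolding clamped_def
  proof (intro conjI allI impI ballI)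
    show "continuous_on {0..1} (?D (2 * k))" using continuous_on_eq[OF c] 2 by simp
    show "?D s 0 = 0" "?D s 1 = 0" if "s < k" for s
      using b[OF that] by (auto intro!: nth_deriv_eq[OF S])
  qed (use nth_deriv_has_derivative[OF S] V in blast)
qed

section \<open>Weakly singular kernels\<close>

text \<open>For nonnegative functions gauge and Lebesgue integrability coincide. This carries
  singular kernels, whose integrals are known as gauge integrals, into the setting where Fubini
  applies.\<close>

lemma set_integrable_lborel_nonneg:
  fixes f :: "real \<Rightarrow> real"
  assumes [measurable]: "f \<in> borel_measurable borel" "S \<in> sets borel"
    and nn: "\<And>x. x \<in> S \<Longrightarrow> 0 \<le> f x" and int: "f integrable_on S"
  shows "set_integrable lborel S f"
proof -
  have "f absolutely_integrable_on S"
    using nn int by (subst absolutely_integrable_on_iff_nonneg) auto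
  then show ?thesis
    unfolding set_integrable_def by (subst (asm) integrable_completion) auto
qed

text \<open>The factor \<open>p\<close> is bounded on the compact interval, so a multiple of the
  possibly unbounded kernel \<open>\<kappa>\<close> dominates the product.\<close>

lemma weighted_integrable:
  fixes \<kappa> p :: "real \<Rightarrow> real"
  assumes [measurable]: "\<kappa> \<in> borel_measurable borel" and nn: "\<And>x. x \<in> {a..b} \<Longrightarrow> 0 \<le> \<kappa> x"
    and int: "\<kappa> integrable_on {a..b}" and p: "continuous_on {a..b} p"
  shows "set_integrable lborel {a..b} (\<lambda>x. \<kappa> x * p x)"
proof -
  have "set_integrable lborel {a..b} \<kappa>"
    by (rule set_integrable_lborel_nonneg) (use nn int in auto)
  then have kint: "integrable lborel (\<lambda>x. indicator {a..b} x * \<kappa> x)"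
    by (simp add: set_integrable_def)
  have "compact (p ` {a..b})" by (intro compact_continuous_image[OF p]) simp
  then obtain M where M: "\<And>x. x \<in> {a..b} \<Longrightarrow> \<bar>p x\<bar> \<le> M"
    by (force simp: bounded_iff dest!: compact_imp_bounded)
  have [measurable]: "(\<lambda>x. indicator {a..b} x *\<^sub>R p x) \<in> borel_measurable borel"
    by (rule borel_measurable_continuous_on_indicator[OF _ p]) simp
  show ?thesis
    unfolding set_integrable_def
  proof (rule Bochner_Integration.integrable_bound[OF integrable_mult_right[OF kint, of M]])
    have eq: "(\<lambda>x. indicator {a..b} x *\<^sub>R (\<kappa> x * p x)) = (\<lambda>x. \<kappa> x * (indicator {a..b} x *\<^sub>R p x))"
      by (simp add: mult_ac)
    show "(\<lambda>x. indicator {a..b} x *\<^sub>R (\<kappa> x * p x)) \<in> borel_measurable lborel"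
      unfolding eq by measurable
    show "AE x in lborel. norm (indicator {a..b} x *\<^sub>R (\<kappa> x * p x)) \<le> norm (M * (indicator {a..b} x * \<kappa> x))"
    proof (rule AE_I2)
      fix x
      show "norm (indicator {a..b} x *\<^sub>R (\<kappa> x * p x)) \<le> norm (M * (indicator {a..b} x * \<kappa> x))"
        using M[of x] by (auto simp: indicator_def abs_mult mult.commute[of _ "\<bar>p x\<bar>"] intro!: mult_right_mono)
    qed
  qed
qed

text \<open>Only \<open>\<kappa>\<close> may be singular, and it depends on \<open>x\<close> alone:
  with \<open>c\<close> bounded on the rectangle, a constant times \<open>\<kappa>(x)\<close> is an
  integrable majorant. It serves both the Abel kernel \<open>(t - x) powr (1 - \<alpha>)\<close> and
  the Taylor kernel \<open>x - s\<close>.\<close>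

lemma weighted_fubini:
  fixes \<kappa> :: "real \<Rightarrow> real" and c :: "real \<Rightarrow> real \<Rightarrow> real"
  assumes \<kappa>m[measurable]: "\<kappa> \<in> borel_measurable borel" and nn: "\<And>x. x \<in> {a..b} \<Longrightarrow> 0 \<le> \<kappa> x"
    and int: "\<kappa> integrable_on {a..b}"
    and c: "continuous_on ({a..b} \<times> {a'..b'}) (\<lambda>(x, y). c x y)"
  shows "(\<lambda>y. integral {a..b} (\<lambda>x. \<kappa> x * c x y)) integrable_on {a'..b'}"
    and "integral {a'..b'} (\<lambda>y. integral {a..b} (\<lambda>x. \<kappa> x * c x y)) =
         integral {a..b} (\<lambda>x. \<kappa> x * integral {a'..b'} (c x))"
proof -
  let ?R = "{a..b} \<times> {a'..b'}"
  define k where "k x = indicator {a..b} x * \<kappa> x" for x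
  define g where "g z = indicator ?R z * (case z of (x, y) \<Rightarrow> c x y)" for z
  define f where "f z = k (fst z) * g z" for z
  have gm[measurable]: "g \<in> borel_measurable (lborel \<Otimes>\<^sub>M lborel)"
  proof -
    have "(\<lambda>z. indicator ?R z *\<^sub>R (case z of (x, y) \<Rightarrow> c x y)) \<in> borel_measurable borel"
      by (rule borel_measurable_continuous_on_indicator[OF _ c]) (simp add: closed_Times borel_closed)
    then show ?thesis
      unfolding g_def by (simp add: borel_prod lborel_prod)
  qed
  have km[measurable]: "k \<in> borel_measurable borel" unfolding k_def by measurable
  have "compact ((\<lambda>(x, y). c x y) ` ?R)"
    by (intro compact_continuous_image[OF c] compact_Times) auto
  then obtain M0 where M0: "\<And>x y. x \<in> {a..b} \<Longrightarrow> y \<in> {a'..b'} \<Longrightarrow> \<bar>c x y\<bar> \<le> M0"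
    by (force simp: bounded_iff dest!: compact_imp_bounded)
  \<comment> \<open>\<open>M0\<close> may be negative if the rectangle is empty; the maximum makes
    the bound valid off the rectangle too, where \<open>g\<close> is 0.\<close>
  define M where "M = max 0 M0"
  have M: "\<bar>g (x, y)\<bar> \<le> M * indicator {a'..b'} y" for x y
    using M0[of x y] by (auto simp: g_def M_def indicator_def)
  have "set_integrable lborel {a..b} \<kappa>"
    by (rule set_integrable_lborel_nonneg) (use nn int in auto)
  then have kint: "integrable lborel k"
    unfolding set_integrable_def k_def by simp
  have Mint: "integrable lborel (\<lambda>y. M * indicator {a'..b'} y :: real)"
    by (intro integrable_mult_right) (simp add: integrable_indicator_iff emeasure_lborel_Icc_eq)
  have dom: "integrable (lborel \<Otimes>\<^sub>M lborel) (\<lambda>z. k (fst z) * (M * indicator {a'..b'} (snd z)))"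
  proof (rule lborel_pair.Fubini_integrable)
    have "integrable lborel (\<lambda>x. \<bar>k x\<bar> * (LINT y|lborel. \<bar>M * indicator {a'..b'} y\<bar>))"
      by (intro integrable_mult_left integrable_abs kint)
    then show "integrable lborel (\<lambda>x. LINT y|lborel. norm (k (fst (x, y)) * (M * indicator {a'..b'} (snd (x, y)))))"
      by (simp only: abs_mult fst_conv snd_conv real_norm_def integral_mult_right_zero)
    show "AE x in lborel. integrable lborel (\<lambda>y. k (fst (x, y)) * (M * indicator {a'..b'} (snd (x, y))))"
      unfolding fst_conv snd_conv by (intro AE_I2 integrable_mult_right Mint)
  qed simp
  have fint: "integrable (lborel \<Otimes>\<^sub>M lborel) f"
  proof (rule Bochner_Integration.integrable_bound[OF dom])
    show "AE z in lborel \<Otimes>\<^sub>M lborel. norm (f z) \<le> norm (k (fst z) * (M * indicator {a'..b'} (snd z)))"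
    proof (rule AE_I2)
      fix z :: "real \<times> real"
      show "norm (f z) \<le> norm (k (fst z) * (M * indicator {a'..b'} (snd z)))"
        using M[of "fst z" "snd z"]
        by (auto simp: f_def abs_mult M_def intro!: mult_left_mono)
    qed
  next
    show "f \<in> borel_measurable (lborel \<Otimes>\<^sub>M lborel)" unfolding f_def[abs_def] by measurable
  qed
  then have fint': "integrable (lborel \<Otimes>\<^sub>M lborel) (case_prod (\<lambda>x y. f (x, y)))" by simp
  have inner_x: "(LINT x|lborel. f (x, y)) = indicator {a'..b'} y *\<^sub>R integral {a..b} (\<lambda>x. \<kappa> x * c x y)" for y
  proof (cases "y \<in> {a'..b'}")
    case True
    have "continuous_on {a..b} (\<lambda>x. (\<lambda>(x, y). c x y) (x, y))"
      by (rule continuous_on_compose2[OF c]) (use True in \<open>auto intro!: continuous_intros\<close>)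
    then have "set_integrable lborel {a..b} (\<lambda>x. \<kappa> x * c x y)"
      by (intro weighted_integrable \<kappa>m nn int) auto
    from set_borel_integral_eq_integral(2)[OF this]
    have "(LINT x|lborel. indicator {a..b} x *\<^sub>R (\<kappa> x * c x y)) = integral {a..b} (\<lambda>x. \<kappa> x * c x y)"
      by (simp only: set_lebesgue_integral_def)
    moreover have "(\<lambda>x. f (x, y)) = (\<lambda>x. indicator {a..b} x *\<^sub>R (\<kappa> x * c x y))"
      using True by (auto simp: f_def k_def g_def indicator_def)
    ultimately show ?thesis using True by simp
  qed (simp add: f_def g_def)
  have inner_y: "(LINT y|lborel. f (x, y)) = indicator {a..b} x *\<^sub>R (\<kappa> x * integral {a'..b'} (c x))" for x
  proof (cases "x \<in> {a..b}")
    case True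
    have "continuous_on {a'..b'} (\<lambda>y. (\<lambda>(x, y). c x y) (x, y))"
      by (rule continuous_on_compose2[OF c]) (use True in \<open>auto intro!: continuous_intros\<close>)
    then have "set_integrable lborel {a'..b'} (c x)"
      unfolding set_integrable_def by (intro borel_integrable_compact) auto
    from set_borel_integral_eq_integral(2)[OF this]
    show ?thesis using True
      by (simp add: set_lebesgue_integral_def f_def k_def g_def indicator_times mult_ac)
  qed (simp add: f_def k_def)
  have "set_integrable lborel {a'..b'} (\<lambda>y. integral {a..b} (\<lambda>x. \<kappa> x * c x y))"
    unfolding set_integrable_def inner_x[symmetric] by (rule lborel_pair.integrable_snd[OF fint'])
  note Y = set_borel_integral_eq_integral[OF this]
  have "set_integrable lborel {a..b} (\<lambda>x. \<kappa> x * integral {a'..b'} (c x))"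
    unfolding set_integrable_def inner_y[symmetric] by (rule lborel_pair.integrable_fst[OF fint'])
  note X = set_borel_integral_eq_integral[OF this]
  show "(\<lambda>y. integral {a..b} (\<lambda>x. \<kappa> x * c x y)) integrable_on {a'..b'}" by (rule Y(1))
  show "integral {a'..b'} (\<lambda>y. integral {a..b} (\<lambda>x. \<kappa> x * c x y)) =
         integral {a..b} (\<lambda>x. \<kappa> x * integral {a'..b'} (c x))"
    using lborel_pair.Fubini_integral[OF fint']
    by (simp add: Y(2)[symmetric] X(2)[symmetric] set_lebesgue_integral_def inner_x inner_y)
qed

section \<open>Euler and Abel integrals\<close>

lemma has_integral_reflect_0:
  fixes f :: "real \<Rightarrow> real"
  assumes "(f has_integral I) {0..c}"
  shows "((\<lambda>t. f (c - t)) has_integral I) {0..c}"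
  using has_integral_affinity[of f I 0 c "- 1" c] assms
  by (simp add: image_diff_atLeastAtMost)

lemma has_integral_kernel:
  fixes t a :: real
  assumes "0 \<le> t" "- 1 < a"
  shows "((\<lambda>\<tau>. (t - \<tau>) powr a) has_integral t powr (a + 1) / (a + 1)) {0..t}"
  by (rule has_integral_reflect_0, rule has_integral_powr_from_0) (use assms in auto)

text \<open>The Beta integral on \<open>[0, 1]\<close>, moved by the affine substitution that maps
  \<open>\<tau>\<close> to 0 and \<open>x\<close> to 1. The two powers and the length element
  contribute \<open>l^(a - 1)\<close>, \<open>l^(b - 1)\<close> and \<open>l\<close>.\<close>

lemma has_integral_beta_interval:
  fixes a b :: real
  assumes "0 < a" "0 < b" "\<tau> < x"
  shows "((\<lambda>t. (x - t) powr (b - 1) * (t - \<tau>) powr (a - 1)) has_integral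
     (x - \<tau>) powr (a + b - 1) * Beta a b) {\<tau>..x}"
proof -
  define l where "l = x - \<tau>"
  have l: "0 < l" using assms by (simp add: l_def)
  have 1: "0 / (1 / l) = 0" "\<And>z. z / (1 / l) = z * l" by simp_all
  have "((\<lambda>t. ((1 / l) *\<^sub>R t + - \<tau> / l) powr (a - 1) * (1 - ((1 / l) *\<^sub>R t + - \<tau> / l)) powr (b - 1))
     has_integral (Beta a b /\<^sub>R (1 / l) ^ DIM(real)))
     (cbox ((0 - - \<tau> / l) /\<^sub>R (1 / l)) ((1 - - \<tau> / l) /\<^sub>R (1 / l)))"
    using has_integral_affinity'[of "\<lambda>t. t powr (a - 1) * (1 - t) powr (b - 1)" "Beta a b" 0 1 "1 / l" "- \<tau> / l"]
      has_integral_Beta_real[OF assms(1,2)] l by simp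
  moreover have "(0 - - \<tau> / l) /\<^sub>R (1 / l) = \<tau>" "(1 - - \<tau> / l) /\<^sub>R (1 / l) = x"
    using l by (simp_all add: field_simps l_def)
  moreover have "(1 / l) *\<^sub>R t + - \<tau> / l = (t - \<tau>) / l" for t
    by (simp add: diff_divide_distrib)
  moreover have "1 - (t - \<tau>) / l = (x - t) / l" for t
    using l by (simp add: field_simps) (simp add: l_def)
  ultimately have "((\<lambda>t. ((t - \<tau>) / l) powr (a - 1) * ((x - t) / l) powr (b - 1)) has_integral l * Beta a b) {\<tau>..x}"
    using l by simp
  then have "((\<lambda>t. l powr (a + b - 2) * (((t - \<tau>) / l) powr (a - 1) * ((x - t) / l) powr (b - 1)))
      has_integral l powr (a + b - 2) * (l * Beta a b)) {\<tau>..x}"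
    by (rule has_integral_mult_right)
  then show ?thesis
  proof (rule has_integral_eq_rhs[OF has_integral_eq, rotated])
    have "l powr (a + b - 1) = l powr (a + b - 2) * l powr 1"
      by (simp only: powr_add[symmetric]) simp
    then show "(x - \<tau>) powr (a + b - 1) * Beta a b = l powr (a + b - 2) * (l * Beta a b)"
      using l by (simp add: l_def[symmetric])
    fix t assume "t \<in> {\<tau>..x}"
    then have "((t - \<tau>) / l) powr (a - 1) * ((x - t) / l) powr (b - 1)
       = (t - \<tau>) powr (a - 1) * (x - t) powr (b - 1) / (l powr (a - 1) * l powr (b - 1))"
      using l by (simp add: powr_divide)
    moreover have "l powr (a + b - 2) = l powr (a - 1) * l powr (b - 1)"
      by (simp flip: powr_add add: algebra_simps)
    ultimately show "l powr (a + b - 2) * (((t - \<tau>) / l) powr (a - 1) * ((x - t) / l) powr (b - 1))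
       = (x - t) powr (b - 1) * (t - \<tau>) powr (a - 1)"
      using l by simp
  qed
qed

text \<open>The kernels \<open>t powr (1 - \<alpha>)\<close> and \<open>t powr (\<alpha> - 2)\<close> convolve to a constant.\<close>

lemma abel_composition:
  fixes p :: "real \<Rightarrow> real"
  assumes \<alpha>: "1 < \<alpha>" "\<alpha> < 2" and p: "continuous_on {0..x} p"
  defines "F \<equiv> \<lambda>t. integral {0..t} (\<lambda>\<tau>. (t - \<tau>) powr (1 - \<alpha>) * p \<tau>)"
  shows "((\<lambda>t. (x - t) powr (\<alpha> - 2) * F t) has_integral Beta (2 - \<alpha>) (\<alpha> - 1) * integral {0..x} p) {0..x}"
proof -
  let ?B = "Beta (2 - \<alpha>) (\<alpha> - 1)"
  define q where "q \<tau> = indicator {0..x} \<tau> *\<^sub>R p \<tau>" for \<tau>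
  have qm[measurable]: "q \<in> borel_measurable borel"
    unfolding q_def by (rule borel_measurable_continuous_on_indicator[OF _ p]) simp
  define k where "k \<tau> t = (if 0 \<le> \<tau> \<and> \<tau> < x \<and> \<tau> \<le> t \<and> t \<le> x
      then (x - t) powr (\<alpha> - 2) * (t - \<tau>) powr (1 - \<alpha>) else 0)" for \<tau> t
  have km[measurable]: "(\<lambda>z. k (fst z) (snd z)) \<in> borel_measurable (lborel \<Otimes>\<^sub>M lborel)"
    unfolding k_def by measurable
  have k: "integrable lborel (k \<tau>)" "integral\<^sup>L lborel (k \<tau>) = indicator {0..<x} \<tau> * ?B" for \<tau>
  proof -
    show "integrable lborel (k \<tau>)" "integral\<^sup>L lborel (k \<tau>) = indicator {0..<x} \<tau> * ?B"
    proof (atomize (full), cases "\<tau> \<in> {0..<x}")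
      case False
      then have "k \<tau> = (\<lambda>_. 0)" by (auto simp: k_def)
      then show "integrable lborel (k \<tau>) \<and> integral\<^sup>L lborel (k \<tau>) = indicator {0..<x} \<tau> * ?B"
        using False by simp
    next
      case True
      let ?h = "\<lambda>t. (x - t) powr (\<alpha> - 2) * (t - \<tau>) powr (1 - \<alpha>)"
      \<comment> \<open>The parameters \<open>2 - \<alpha>\<close> and \<open>\<alpha> - 1\<close>
        add up to 1, so the power of \<open>x - \<tau>\<close> in the Beta integral has exponent 0:
        the mass of \<open>k \<tau>\<close> is the same for all \<open>\<tau>\<close> in
        \<open>[0, x)\<close>.\<close>
      have hi: "(?h has_integral ?B) {\<tau>..x}"
        using has_integral_beta_interval[of "2 - \<alpha>" "\<alpha> - 1" \<tau> x] \<alpha> True by simp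
      have "set_integrable lborel {\<tau>..x} ?h"
        by (rule set_integrable_lborel_nonneg) (use hi in auto)
      moreover have "k \<tau> = (\<lambda>t. indicator {\<tau>..x} t *\<^sub>R ?h t)"
        using True by (auto simp: k_def indicator_def)
      ultimately show "integrable lborel (k \<tau>) \<and> integral\<^sup>L lborel (k \<tau>) = indicator {0..<x} \<tau> * ?B"
        using set_borel_integral_eq_integral(2)[of "{\<tau>..x}" ?h] integral_unique[OF hi] True
        by (simp add: set_integrable_def set_lebesgue_integral_def)
    qed
  qed
  have knn: "\<bar>k \<tau> t\<bar> = k \<tau> t" for \<tau> t by (simp add: k_def)
  have qint: "integrable lborel q"
    unfolding q_def by (rule borel_integrable_compact[OF _ p]) simp
  have int: "integrable (lborel \<Otimes>\<^sub>M lborel) (case_prod (\<lambda>\<tau> t. q \<tau> * k \<tau> t))"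
  proof (rule lborel_pair.Fubini_integrable)
    have "integrable lborel (\<lambda>\<tau>. ?B * (indicator {0..<x} \<tau> * \<bar>q \<tau>\<bar>))"
      using integrable_mult_indicator[of "{0..<x}" lborel "\<lambda>\<tau>. \<bar>q \<tau>\<bar>"] qint by simp
    then show "integrable lborel (\<lambda>\<tau>. LINT t|lborel. norm (case (\<tau>, t) of (\<tau>, t) \<Rightarrow> q \<tau> * k \<tau> t))"
      by (simp add: abs_mult knn k mult_ac)
    show "AE \<tau> in lborel. integrable lborel (\<lambda>t. case (\<tau>, t) of (\<tau>, t) \<Rightarrow> q \<tau> * k \<tau> t)"
      by (simp add: k)
  qed (simp add: case_prod_beta')
  have inner: "(LINT \<tau>|lborel. q \<tau> * k \<tau> t) = indicator {0..x} t *\<^sub>R ((x - t) powr (\<alpha> - 2) * F t)" for t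
  proof (cases "t \<in> {0..<x}")
    case True
    have "set_integrable lborel {0..t} (\<lambda>\<tau>. (t - \<tau>) powr (1 - \<alpha>) * p \<tau>)"
      by (rule weighted_integrable[OF _ _ _ continuous_on_subset[OF p]])
        (use True \<alpha> has_integral_kernel[of t "1 - \<alpha>"] in auto)
    from set_borel_integral_eq_integral(2)[OF this]
    have "(LINT \<tau>|lborel. indicator {0..t} \<tau> *\<^sub>R ((t - \<tau>) powr (1 - \<alpha>) * p \<tau>)) = F t"
      by (simp add: set_lebesgue_integral_def F_def)
    moreover have "(\<lambda>\<tau>. q \<tau> * k \<tau> t) = (\<lambda>\<tau>. (x - t) powr (\<alpha> - 2) * (indicator {0..t} \<tau> *\<^sub>R ((t - \<tau>) powr (1 - \<alpha>) * p \<tau>)))"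
      using True by (auto simp: q_def k_def indicator_def fun_eq_iff)
    ultimately show ?thesis using True by simp
  next
    case False
    \<comment> \<open>This includes \<open>t = x\<close>, where
      \<open>0 powr (\<alpha> - 2) = 0\<close> makes both sides vanish.\<close>
    then have "(\<lambda>\<tau>. q \<tau> * k \<tau> t) = (\<lambda>\<tau>. 0)"
      by (auto simp: k_def fun_eq_iff)
    then show ?thesis using False by (auto simp: indicator_def)
  qed
  have "set_integrable lborel {0..x} (\<lambda>t. (x - t) powr (\<alpha> - 2) * F t)"
    unfolding set_integrable_def inner[symmetric] by (rule lborel_pair.integrable_snd[OF int])
  note T = set_borel_integral_eq_integral[OF this]
  have "integral {0..x} (\<lambda>t. (x - t) powr (\<alpha> - 2) * F t) = (LINT t|lborel. LINT \<tau>|lborel. q \<tau> * k \<tau> t)"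
    using T(2) by (simp add: inner set_lebesgue_integral_def)
  also have "\<dots> = (LINT \<tau>|lborel. LINT t|lborel. q \<tau> * k \<tau> t)"
    by (rule lborel_pair.Fubini_integral[OF int])
  also have "\<dots> = (LINT \<tau>|lborel. ?B * q \<tau>)"
  proof (rule integral_cong_AE)
    \<comment> \<open>At \<open>\<tau> = x\<close> the kernel \<open>k \<tau>\<close> has mass 0
      while \<open>q\<close> need not vanish, so the equality holds only almost everywhere.\<close>
    have "AE \<tau> in lborel. \<tau> \<noteq> x" by (rule AE_lborel_singleton)
    then show "AE \<tau> in lborel. (LINT t|lborel. q \<tau> * k \<tau> t) = ?B * q \<tau>"
      by eventually_elim (auto simp: k q_def indicator_def)
    show "(\<lambda>\<tau>. LINT t|lborel. q \<tau> * k \<tau> t) \<in> borel_measurable lborel"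
      by (simp add: k)
  qed simp
  also have "\<dots> = ?B * integral {0..x} p"
    using set_borel_integral_eq_integral(2)[of "{0..x}" p] qint
    by (simp add: set_integrable_def set_lebesgue_integral_def q_def[abs_def])
  finally show ?thesis using T(1) by (metis integrable_integral)
qed

section \<open>Inverting the Abel kernel\<close>

lemma derivative_le_lipschitz:
  fixes Q :: "real \<Rightarrow> real"
  assumes d: "(Q has_real_derivative d) (at x within {0..x})" and x: "0 < x"
    and L: "\<And>z. z \<in> {0..x} \<Longrightarrow> \<bar>Q x - Q z\<bar> \<le> L * (x - z)"
  shows "\<bar>d\<bar> \<le> L"
proof -
  have "((\<lambda>z. \<bar>(Q z - Q x) / (z - x)\<bar>) \<longlongrightarrow> \<bar>d\<bar>) (at x within {0..x})"
    using d by (intro tendsto_rabs) (simp add: has_field_derivative_iff)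
  moreover have "\<forall>\<^sub>F z in at x within {0..x}. \<bar>(Q z - Q x) / (z - x)\<bar> \<le> L"
    unfolding eventually_at_filter
  proof (intro always_eventually allI impI)
    fix z assume z: "z \<noteq> x" "z \<in> {0..x}"
    have "\<bar>Q z - Q x\<bar> \<le> L * \<bar>z - x\<bar>" using L[OF z(2)] z by (simp add: abs_if split: if_splits)
    then show "\<bar>(Q z - Q x) / (z - x)\<bar> \<le> L" using z by (simp add: field_simps)
  qed
  moreover have "at x within {0..x} \<noteq> bot" using x by (simp add: trivial_limit_within)
  ultimately show ?thesis by (rule tendsto_upperbound)
qed

text \<open>Splitting \<open>t - s\<close> takes the parameter out of the integrand; the product
  rule then produces two terms \<open>t * H t\<close> that cancel.\<close>

lemma double_integral_has_derivative:
  fixes H :: "real \<Rightarrow> real"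
  assumes H: "continuous_on {0..b} H" and t: "t \<in> {0..b}"
  shows "((\<lambda>t. integral {0..t} (\<lambda>s. (t - s) * H s)) has_real_derivative integral {0..t} H)
    (at t within {0..b})"
proof -
  have c: "continuous_on {0..b} (\<lambda>s. s * H s)" by (intro continuous_intros H)
  have eq: "integral {0..t} (\<lambda>s. (t - s) * H s) = t * integral {0..t} H - integral {0..t} (\<lambda>s. s * H s)"
    if "t \<in> {0..b}" for t
  proof -
    have i: "H integrable_on {0..t}" "(\<lambda>s. s * H s) integrable_on {0..t}"
      by (rule integrable_continuous_real, rule continuous_on_subset, rule H c, use that in auto)+
    then have "integral {0..t} (\<lambda>s. t * H s - s * H s) = t * integral {0..t} H - integral {0..t} (\<lambda>s. s * H s)"
      by (subst integral_diff) (auto intro: integrable_on_mult_right)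
    then show ?thesis by (simp add: algebra_simps)
  qed
  have "((\<lambda>t. t * integral {0..t} H - integral {0..t} (\<lambda>s. s * H s)) has_real_derivative
      (1 * integral {0..t} H + H t * t - t * H t)) (at t within {0..b})"
    using integral_has_vector_derivative[OF H t] integral_has_vector_derivative[OF c t]
    unfolding has_real_derivative_iff_has_vector_derivative[symmetric]
    by (intro DERIV_diff DERIV_mult' DERIV_mult DERIV_ident)
  then show ?thesis
    using eq t by (auto intro: has_field_derivative_transform_within[of _ _ _ _ 1] simp: algebra_simps)
qed

text \<open>By \<open>abel_composition\<close>, \<open>integral {0..z} p\<close> is, up to a factor, the integral of
  \<open>\<sigma> powr (\<alpha> - 2) * G (z - \<sigma>)\<close> for the double antiderivative \<open>G\<close> of \<open>H\<close> extended by \<open>0\<close>. As \<open>G\<close> is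
  Lipschitz with constant \<open>L\<close>, so is that integral, up to a factor, and this bounds its derivative \<open>p\<close>.\<close>

lemma abel_bound:
  fixes p H :: "real \<Rightarrow> real"
  assumes \<alpha>: "1 < \<alpha>" "\<alpha> < 2" and x: "0 < x"
    and p: "continuous_on {0..x} p" and H: "continuous_on {0..x} H"
    and F: "\<And>t. t \<in> {0..<x} \<Longrightarrow>
        integral {0..t} (\<lambda>\<tau>. (t - \<tau>) powr (1 - \<alpha>) * p \<tau>) = integral {0..t} (\<lambda>s. (t - s) * H s)"
    and L: "\<And>t. t \<in> {0..x} \<Longrightarrow> \<bar>integral {0..t} H\<bar> \<le> L"
  shows "Beta (2 - \<alpha>) (\<alpha> - 1) * \<bar>p x\<bar> \<le> L * x powr (\<alpha> - 1) / (\<alpha> - 1)"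
proof -
  let ?B = "Beta (2 - \<alpha>) (\<alpha> - 1)"
  \<comment> \<open>With the value 0 for negative arguments, \<open>G (x - \<sigma>)\<close> and
    \<open>G (z - \<sigma>)\<close> can be integrated over the same interval \<open>{0..x}\<close>
    and subtracted pointwise.\<close>
  define G where "G t = (if t < 0 then 0 else integral {0..t} (\<lambda>s. (t - s) * H s))" for t
  have L0: "0 \<le> L" using L[of 0] x by simp
  have G1: "\<bar>G t - G t'\<bar> \<le> L * \<bar>t - t'\<bar>" if "t \<in> {0..x}" "t' \<in> {0..x}" for t t'
  proof -
    have "norm (G t - G t') \<le> L * norm (t - t')"
    proof (rule field_differentiable_bound[of "{0..x}" G "\<lambda>t. integral {0..t} H"])
      fix z assume z: "z \<in> {0..x}"
      show "(G has_field_derivative integral {0..z} H) (at z within {0..x})"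
        by (rule has_field_derivative_transform_within[OF double_integral_has_derivative[OF H z] _ z, of 1])
          (auto simp: G_def)
      show "norm (integral {0..z} H) \<le> L" using L[OF z] by simp
    qed (use that in auto)
    then show ?thesis by simp
  qed
  have G: "\<bar>G t - G t'\<bar> \<le> L * (t - t')" if "t' \<le> t" "t \<le> x" for t t'
  proof (cases "t' < 0")
    case False
    then show ?thesis using G1[of t t'] that by auto
  next
    case True
    have "\<bar>G t\<bar> \<le> L * (t - t')"
    proof (cases "t < 0")
      case False
      then have "\<bar>G t\<bar> \<le> L * t" using G1[of t 0] that x by (simp add: G_def)
      also have "\<dots> \<le> L * (t - t')" using True L0 by (intro mult_left_mono) auto
      finally show ?thesis .
    qed (use that L0 in \<open>simp add: G_def\<close>)
    then show ?thesis using True by (simp add: G_def)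
  qed
  define Q where "Q z = ?B * integral {0..z} p" for z
  have Q: "((\<lambda>\<sigma>. \<sigma> powr (\<alpha> - 2) * G (z - \<sigma>)) has_integral Q z) {0..x}" if z: "z \<in> {0..x}" for z
  proof -
    have "((\<lambda>t. (z - t) powr (\<alpha> - 2) * integral {0..t} (\<lambda>\<tau>. (t - \<tau>) powr (1 - \<alpha>) * p \<tau>)) has_integral Q z) {0..z}"
      unfolding Q_def by (rule abel_composition[OF \<alpha> continuous_on_subset[OF p]]) (use z in auto)
    \<comment> \<open>For \<open>z = x\<close> the hypothesis \<open>F\<close> says nothing at
      \<open>t = x\<close>; this single point does not affect the integral.\<close>
    then have "((\<lambda>t. (z - t) powr (\<alpha> - 2) * G t) has_integral Q z) {0..z}"
      by (rule has_integral_spike_finite[of "{z}", rotated 2]) (use z F in \<open>auto simp: G_def\<close>)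
    from has_integral_reflect_0[OF this]
    have "((\<lambda>\<sigma>. \<sigma> powr (\<alpha> - 2) * G (z - \<sigma>)) has_integral Q z) {0..z}" by simp
    moreover have "((\<lambda>\<sigma>. \<sigma> powr (\<alpha> - 2) * G (z - \<sigma>)) has_integral 0) {z..x}"
      by (rule has_integral_spike_finite[where S = "{z}" and f = "\<lambda>_. 0"]) (auto simp: G_def)
    ultimately show ?thesis
      using has_integral_combine[of 0 z x _ "Q z" 0] z by simp
  qed
  have W: "((\<lambda>\<sigma>. \<sigma> powr (\<alpha> - 2)) has_integral x powr (\<alpha> - 1) / (\<alpha> - 1)) {0..x}"
    using has_integral_powr_from_0[of "\<alpha> - 2" x] \<alpha> x by simp
  have "\<bar>?B * p x\<bar> \<le> L * x powr (\<alpha> - 1) / (\<alpha> - 1)"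
  proof (rule derivative_le_lipschitz[OF _ x])
    show "(Q has_real_derivative ?B * p x) (at x within {0..x})"
      unfolding Q_def
      using integral_has_vector_derivative[OF p, of x] x
      by (intro DERIV_cmult) (simp add: has_real_derivative_iff_has_vector_derivative)
    fix z assume z: "z \<in> {0..x}"
    have "norm (integral {0..x} (\<lambda>\<sigma>. \<sigma> powr (\<alpha> - 2) * G (x - \<sigma>) - \<sigma> powr (\<alpha> - 2) * G (z - \<sigma>)))
       \<le> integral {0..x} (\<lambda>\<sigma>. (L * (x - z)) * \<sigma> powr (\<alpha> - 2))"
    proof (rule integral_norm_bound_integral)
      show "(\<lambda>\<sigma>. \<sigma> powr (\<alpha> - 2) * G (x - \<sigma>) - \<sigma> powr (\<alpha> - 2) * G (z - \<sigma>)) integrable_on {0..x}"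
        using Q[of x] Q[OF z] x by (intro integrable_diff) auto
      show "(\<lambda>\<sigma>. (L * (x - z)) * \<sigma> powr (\<alpha> - 2)) integrable_on {0..x}"
        using W by (intro integrable_on_mult_right) auto
      fix \<sigma> assume "\<sigma> \<in> {0..x}"
      then have "\<bar>G (x - \<sigma>) - G (z - \<sigma>)\<bar> \<le> L * (x - z)"
        using G[of "z - \<sigma>" "x - \<sigma>"] z by simp
      then have "\<sigma> powr (\<alpha> - 2) * \<bar>G (x - \<sigma>) - G (z - \<sigma>)\<bar> \<le> \<sigma> powr (\<alpha> - 2) * (L * (x - z))"
        by (intro mult_left_mono) auto
      then show "norm (\<sigma> powr (\<alpha> - 2) * G (x - \<sigma>) - \<sigma> powr (\<alpha> - 2) * G (z - \<sigma>)) \<le> (L * (x - z)) * \<sigma> powr (\<alpha> - 2)"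
        unfolding right_diff_distrib[symmetric] real_norm_def abs_mult by (simp only: mult.commute abs_of_nonneg powr_ge_zero)
    qed
    moreover have "integral {0..x} (\<lambda>\<sigma>. \<sigma> powr (\<alpha> - 2) * G (x - \<sigma>) - \<sigma> powr (\<alpha> - 2) * G (z - \<sigma>)) = Q x - Q z"
      using Q[of x] Q[OF z] x by (intro integral_unique has_integral_diff) auto
    moreover have "integral {0..x} (\<lambda>\<sigma>. (L * (x - z)) * \<sigma> powr (\<alpha> - 2)) = (L * (x - z)) * (x powr (\<alpha> - 1) / (\<alpha> - 1))"
      using W by (intro integral_unique has_integral_mult_right) auto
    ultimately show "\<bar>Q x - Q z\<bar> \<le> L * x powr (\<alpha> - 1) / (\<alpha> - 1) * (x - z)"
      by (simp add: mult_ac)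
  qed
  moreover have "0 \<le> ?B"
    using \<alpha> by (simp add: Beta_def Gamma_real_pos less_imp_le)
  ultimately show ?thesis by (simp add: abs_mult)
qed

text \<open>\<open>F\<close> is only controlled on the open interval, where it differs from the double integral by an
  affine function; the condition at \<open>0\<close> forces this function to vanish.\<close>

lemma double_antiderivative_eq:
  fixes F H :: "real \<Rightarrow> real"
  assumes H: "continuous_on {0..1} H"
    and F: "\<And>a x. 0 < a \<Longrightarrow> a < x \<Longrightarrow> x < 1 \<Longrightarrow>
       F x = F a + (x - a) * b a + integral {a..x} (\<lambda>s. (x - s) * H s)"
    and lim: "((\<lambda>x. F x / x) \<longlongrightarrow> 0) (at_right 0)"
    and x: "x \<in> {0<..<1}"
  shows "F x = integral {0..x} (\<lambda>s. (x - s) * H s)"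
proof -
  define G where "G t = integral {0..t} (\<lambda>s. (t - s) * H s)" for t
  define R where "R t = F t - G t" for t
  have Gd: "(G has_real_derivative integral {0..t} H) (at t within {0..1})" if "t \<in> {0..1}" for t
    unfolding G_def by (rule double_integral_has_derivative[OF H that])
  have R: "\<exists>c. \<forall>x. a < x \<and> x < 1 \<longrightarrow> R x - R a = (x - a) * c" if a: "0 < a" "a < 1" for a
  proof (intro exI allI impI)
    fix x assume x: "a < x \<and> x < 1"
    have int: "(\<lambda>s. g s * H s) integrable_on {u..v}" if "0 \<le> u" "v \<le> 1" "continuous_on UNIV g" for g u v
      by (intro integrable_continuous_real continuous_intros continuous_on_subset[OF H] continuous_on_subset[OF that(3)])
        (use that in auto)
    have "G x = integral {0..a} (\<lambda>s. (x - s) * H s) + integral {a..x} (\<lambda>s. (x - s) * H s)"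
      unfolding G_def
      by (rule Henstock_Kurzweil_Integration.integral_combine[symmetric])
         (use a x in \<open>auto intro!: int continuous_intros\<close>)
    also have "integral {0..a} (\<lambda>s. (x - s) * H s) = integral {0..a} (\<lambda>s. (a - s) * H s + (x - a) * H s)"
      by (rule arg_cong[where f = "integral _"]) (auto simp: algebra_simps)
    also have "\<dots> = G a + (x - a) * integral {0..a} H"
      unfolding G_def using int[of 0 a "\<lambda>s. a - s"] int[of 0 a "\<lambda>s. x - a"] a
        continuous_on_diff[OF continuous_on_const continuous_on_id, of UNIV a]
      by (subst integral_add) auto
    \<comment> \<open>On \<open>(a, 1)\<close> the difference \<open>R\<close> is affine, with a
      slope that still depends on \<open>a\<close>.\<close>
    finally show "R x - R a = (x - a) * (b a - integral {0..a} H)"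
      using F[of a x] a x by (simp add: R_def algebra_simps)
  qed
  have "((\<lambda>t. G t / t) \<longlongrightarrow> 0) (at 0 within {0..1})"
    using Gd[of 0] by (simp add: has_field_derivative_iff G_def)
  then have "((\<lambda>t. G t / t) \<longlongrightarrow> 0) (at_right 0)"
    by (simp add: at_within_Icc_at_right)
  from tendsto_diff[OF lim this] have Rl: "((\<lambda>t. R t / t) \<longlongrightarrow> 0) (at_right 0)"
    by (simp add: R_def diff_divide_distrib)
  have "((\<lambda>t. R t / t * t) \<longlongrightarrow> 0 * 0) (at_right 0)"
    by (intro tendsto_mult Rl tendsto_ident_at)
  moreover have "\<forall>\<^sub>F t in at_right 0. R t / t * t = R t"
    using eventually_at_right_less[of 0] by eventually_elim auto
  ultimately have R0: "(R \<longlongrightarrow> 0) (at_right 0)"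
    using Lim_transform_eventually[of "\<lambda>t. R t / t * t" 0 "at_right 0" R] by simp
  have "R x / x = R c / c" if c: "0 < c" "c < x" for c
  proof -
    \<comment> \<open>Cross-multiplying eliminates the slope, so that \<open>a\<close> can tend to 0
      without any information on \<open>b a\<close>.\<close>
    have ev: "\<forall>\<^sub>F a in at_right 0. (R x - R a) * (c - a) = (R c - R a) * (x - a)"
      unfolding eventually_at_right_field
    proof (intro exI conjI allI impI)
      show "0 < c" by (rule c)
      fix a assume a: "0 < a" "a < c"
      then obtain d where "\<forall>x. a < x \<and> x < 1 \<longrightarrow> R x - R a = (x - a) * d"
        using R[of a] c x by auto
      then have "R x - R a = (x - a) * d" "R c - R a = (c - a) * d" using a c x by auto
      then show "(R x - R a) * (c - a) = (R c - R a) * (x - a)" by simp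
    qed
    have l: "((\<lambda>a. (R x - R a) * (c - a)) \<longlongrightarrow> (R x - 0) * (c - 0)) (at_right 0)"
      "((\<lambda>a. (R c - R a) * (x - a)) \<longlongrightarrow> (R c - 0) * (x - 0)) (at_right 0)"
      by (intro tendsto_intros R0)+
    have "(R x - 0) * (c - 0) = (R c - 0) * (x - 0)"
      by (rule tendsto_unique[OF _ Lim_transform_eventually[OF l(1) ev] l(2)]) simp
    then show ?thesis using c by (simp add: field_simps)
  qed
  \<comment> \<open>The ratio is constant in \<open>c\<close>, and \<open>Rl\<close> says that it
    tends to 0.\<close>
  then have "\<forall>\<^sub>F c in at_right 0. R c / c = R x / x"
    unfolding eventually_at_right_field using x by (intro exI[of _ x]) auto
  then have "((\<lambda>c. R x / x) \<longlongrightarrow> 0) (at_right (0::real))"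
    by (rule Lim_transform_eventually[OF Rl])
  then have "R x / x = 0" by (simp add: tendsto_const_iff)
  then show ?thesis using x by (simp add: R_def G_def)
qed

section \<open>Moments in the second variable\<close>

lemma continuous_on_slice:
  assumes "continuous_on (S \<times> T) (\<lambda>(x, y). f x y)" "x \<in> S"
  shows "continuous_on T (f x)"
proof -
  have "continuous_on T (\<lambda>y. (\<lambda>(x, y). f x y) (x, y))"
    by (rule continuous_on_compose2[OF assms(1)]) (use assms(2) in \<open>auto intro!: continuous_intros\<close>)
  then show ?thesis by simp
qed

lemma continuous_on_mult_snd:
  assumes "continuous_on (S \<times> T) (\<lambda>(x, y). f x y)" "continuous_on T E"
  shows "continuous_on (S \<times> T) (\<lambda>(x, y). f x y * E y :: real)"
proof -
  have "continuous_on (S \<times> T) (\<lambda>z. (case z of (x, y) \<Rightarrow> f x y) * E (snd z))"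
    by (intro continuous_on_mult assms(1) continuous_on_compose2[OF assms(2)] continuous_intros) auto
  then show ?thesis by (simp add: case_prod_beta')
qed

text \<open>The expansion point is some \<open>a > 0\<close> because the second derivative is
  available only inside \<open>(0, 1)\<close>. No continuity of \<open>\<Phi>\<close> enters: the
  integrand is an exact derivative.\<close>

lemma taylor_integral_remainder:
  fixes f \<Phi> :: "real \<Rightarrow> real"
  assumes f: "\<And>s. s \<in> {0<..<1} \<Longrightarrow> has_nth_deriv 2 f UNIV s (\<Phi> s)"
    and ax: "0 < a" "a < x" "x < 1"
  shows "((\<lambda>s. (x - s) * \<Phi> s) has_integral f x - f a - (x - a) * nth_deriv f UNIV 1 a) {a..x}"
proof -
  have S: "\<And>z::real. z \<in> UNIV \<Longrightarrow> at z within UNIV \<noteq> bot" by simp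
  let ?D = "nth_deriv f UNIV"
  have D0: "?D 0 = f" using nth_deriv_eq[OF S, where n = 0] by (simp add: fun_eq_iff)
  have D2: "?D 2 s = \<Phi> s" if "s \<in> {0<..<1}" for s
    using nth_deriv_eq[OF S _ f[OF that]] by simp
  have d: "(?D j has_real_derivative ?D (Suc j) s) (at s)" if "s \<in> {0<..<1}" "j < 2" for s j
    by (rule nth_deriv_has_derivative[OF S UNIV_I f[OF that(1)] that(2)])
  have d0: "(f has_real_derivative ?D 1 s) (at s)" if "s \<in> {0<..<1}" for s
    using d[OF that, of 0] by (simp add: D0)
  have d1: "(?D 1 has_real_derivative \<Phi> s) (at s)" if "s \<in> {0<..<1}" for s
    using d[OF that, of 1] unfolding Suc_1 D2[OF that] by simp
  \<comment> \<open>In the derivative of \<open>f + (x - s) f'\<close> the two occurrences of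
    \<open>f'\<close> cancel, leaving \<open>(x - s) f''\<close>.\<close>
  define G where "G s = f s + (x - s) * ?D 1 s" for s
  have "((\<lambda>s. (x - s) * \<Phi> s) has_integral G x - G a) {a..x}"
  proof (rule fundamental_theorem_of_calculus)
    fix s assume "s \<in> {a..x}"
    then have s: "s \<in> {0<..<1}" using ax by auto
    have "(G has_real_derivative (x - s) * \<Phi> s) (at s)"
      unfolding G_def
      by (rule DERIV_cong[OF DERIV_add[OF d0[OF s] DERIV_mult[OF DERIV_diff[OF DERIV_const DERIV_ident] d1[OF s]]]]) simp
    then show "(G has_vector_derivative (x - s) * \<Phi> s) (at s within {a..x})"
      by (simp add: has_field_derivative_at_within flip: has_real_derivative_iff_has_vector_derivative)
  qed (use ax in auto)
  then show ?thesis by (simp add: G_def algebra_simps)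
qed

text \<open>Differentiation under the integral in \<open>y\<close> is avoided. For each
  \<open>y\<close> the Abel integral satisfies Taylor's formula from \<open>a\<close>, and
  integrating this formula against \<open>E\<close> uses only Fubini. The unknown first derivatives
  at \<open>a\<close> enter through one constant, which \<open>double_antiderivative_eq\<close>
  eliminates by means of the behaviour at 0.\<close>

lemma fractional_moment:
  fixes U \<Phi> :: "real \<Rightarrow> real \<Rightarrow> real" and E H :: "real \<Rightarrow> real"
  assumes \<alpha>: "1 < \<alpha>" "\<alpha> < 2"
    and U: "continuous_on ({0..1} \<times> {0..1}) (\<lambda>(x, y). U x y)"
    and RL: "\<And>x y. x \<in> {0<..<1} \<Longrightarrow> y \<in> {0..1} \<Longrightarrow>
        has_nth_deriv 2 (\<lambda>t. integral {0..t} (\<lambda>\<tau>. (t - \<tau>) powr (1 - \<alpha>) * U \<tau> y)) UNIV x (\<Phi> x y)"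
    and \<Phi>: "continuous_on ({0<..<1} \<times> {0..1}) (\<lambda>(x, y). \<Phi> x y)"
    and E: "continuous_on {0..1} E" and H: "continuous_on {0..1} H"
    and H\<Phi>: "\<And>s. s \<in> {0<..<1} \<Longrightarrow> H s = integral {0..1} (\<lambda>y. \<Phi> s y * E y)"
    and p: "\<And>x. p x = integral {0..1} (\<lambda>y. U x y * E y)" and p0: "p 0 = 0"
    and lim: "((\<lambda>x. p x / x powr (\<alpha> - 1)) \<longlongrightarrow> 0) (at_right 0)"
    and t: "t \<in> {0<..<1}"
  shows "integral {0..t} (\<lambda>\<tau>. (t - \<tau>) powr (1 - \<alpha>) * p \<tau>) = integral {0..t} (\<lambda>s. (t - s) * H s)"
proof -
  define F where "F t y = integral {0..t} (\<lambda>\<tau>. (t - \<tau>) powr (1 - \<alpha>) * U \<tau> y)" for t y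
  define D where "D a y = nth_deriv (\<lambda>t. F t y) UNIV 1 a" for a y
  define f where "f t = integral {0..t} (\<lambda>\<tau>. (t - \<tau>) powr (1 - \<alpha>) * p \<tau>)" for t
  define I where "I a x y = integral {a..x} (\<lambda>s. (x - s) * \<Phi> s y)" for a x y
  have kern: "(\<lambda>\<tau>. (t - \<tau>) powr (1 - \<alpha>)) integrable_on {0..t}" if "0 \<le> t" for t
    using has_integral_kernel[OF that, of "1 - \<alpha>"] \<alpha> by auto
  have UE: "continuous_on ({0..1} \<times> {0..1}) (\<lambda>(x, y). U x y * E y)"
    by (rule continuous_on_mult_snd[OF U E])
  have pc: "continuous_on {0..1} p"
    unfolding p[abs_def] using integral_continuous_on_param[of "{0..1}" 0 1 "\<lambda>x y. U x y * E y"] UE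
    by (simp add: cbox_interval)
  have F1: "(\<lambda>y. F t y * E y) integrable_on {0..1}"
    and F2: "integral {0..1} (\<lambda>y. F t y * E y) = f t" if t: "t \<in> {0..1}" for t
  proof -
    have "continuous_on ({0..t} \<times> {0..1}) (\<lambda>(x, y). U x y * E y)"
      by (rule continuous_on_subset[OF UE]) (use t in auto)
    note * = weighted_fubini[OF _ _ kern this]
    have eq: "integral {0..t} (\<lambda>x. (t - x) powr (1 - \<alpha>) * (U x y * E y)) = F t y * E y" for y
      by (simp add: F_def mult.assoc[symmetric])
    show "(\<lambda>y. F t y * E y) integrable_on {0..1}" "integral {0..1} (\<lambda>y. F t y * E y) = f t"
      using *[unfolded eq] t by (simp_all add: f_def p)
  qed
  have I1: "(\<lambda>y. I a x y * E y) integrable_on {0..1}"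
    and I2: "integral {0..1} (\<lambda>y. I a x y * E y) = integral {a..x} (\<lambda>s. (x - s) * H s)"
    if ax: "0 < a" "a < x" "x < 1" for a x
  proof -
    have "continuous_on ({a..x} \<times> {0..1}) (\<lambda>(x, y). \<Phi> x y * E y)"
      by (rule continuous_on_subset[OF continuous_on_mult_snd[OF \<Phi> E]]) (use ax in auto)
    moreover have "(\<lambda>s. x - s) integrable_on {a..x}"
      by (intro integrable_continuous_real continuous_intros)
    ultimately have *: "(\<lambda>y. integral {a..x} (\<lambda>s. (x - s) * (\<Phi> s y * E y))) integrable_on {0..1}"
      "integral {0..1} (\<lambda>y. integral {a..x} (\<lambda>s. (x - s) * (\<Phi> s y * E y))) =
         integral {a..x} (\<lambda>s. (x - s) * integral {0..1} (\<lambda>y. \<Phi> s y * E y))"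
      by (intro weighted_fubini; simp)+
    have eq: "integral {a..x} (\<lambda>s. (x - s) * (\<Phi> s y * E y)) = I a x y * E y" for y
      by (simp add: I_def mult.assoc[symmetric])
    show "(\<lambda>y. I a x y * E y) integrable_on {0..1}" using *(1) unfolding eq .
    show "integral {0..1} (\<lambda>y. I a x y * E y) = integral {a..x} (\<lambda>s. (x - s) * H s)"
      using *(2) unfolding eq
      by (rule trans) (intro Henstock_Kurzweil_Integration.integral_cong, use ax H\<Phi> in auto)
  qed
  have taylor: "f x = f a + (x - a) * integral {0..1} (\<lambda>y. D a y * E y) + integral {a..x} (\<lambda>s. (x - s) * H s)"
    if ax: "0 < a" "a < x" "x < 1" for a x
  proof -
    have I: "I a x y = F x y - F a y - (x - a) * D a y" if "y \<in> {0..1}" for y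
      unfolding I_def D_def
      by (rule integral_unique, rule taylor_integral_remainder[OF _ ax]) (use RL[OF _ that] F_def in auto)
    \<comment> \<open>Nothing is known about the dependence of \<open>D a y\<close> on
      \<open>y\<close>; its integrability is read off from Taylor's formula, whose other terms are
      integrable.\<close>
    have D1: "(\<lambda>y. D a y * E y) integrable_on {0..1}"
    proof (rule integrable_eq)
      show "(\<lambda>y. (F x y * E y - F a y * E y - I a x y * E y) / (x - a)) integrable_on {0..1}"
        using ax by (intro integrable_on_divide integrable_diff F1 I1) auto
      fix y :: real assume y: "y \<in> {0..1}"
      have "F x y * E y - F a y * E y - I a x y * E y = (x - a) * (D a y * E y)"
        unfolding I[OF y] by (simp add: algebra_simps)
      then show "(F x y * E y - F a y * E y - I a x y * E y) / (x - a) = D a y * E y" using ax by simp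
    qed
    have "f x = integral {0..1} (\<lambda>y. F x y * E y)" using F2[of x] ax by simp
    also have "\<dots> = integral {0..1} (\<lambda>y. F a y * E y + (x - a) * (D a y * E y) + I a x y * E y)"
      by (rule Henstock_Kurzweil_Integration.integral_cong) (simp add: I algebra_simps)
    also have "\<dots> = f a + (x - a) * integral {0..1} (\<lambda>y. D a y * E y) + integral {a..x} (\<lambda>s. (x - s) * H s)"
      using ax D1 by (simp add: integral_add F1 I1 I2 F2 integrable_add)
    finally show ?thesis .
  qed
  have "((\<lambda>x. f x / x) \<longlongrightarrow> 0) (at_right 0)"
  proof (rule tendstoI)
    fix e :: real assume e: "0 < e"
    \<comment> \<open>The kernel has integral \<open>x powr (2 - \<alpha>) / (2 - \<alpha>)\<close>,
      so this choice of \<open>d\<close> gives the bound \<open>e / 2 * x\<close> for the Abel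
      integral of \<open>p\<close>.\<close>
    define d where "d = e * (2 - \<alpha>) / 2"
    have d: "0 < d" using e \<alpha> by (simp add: d_def)
    from tendstoD[OF lim d] obtain b where b: "0 < b" "\<And>x. 0 < x \<Longrightarrow> x < b \<Longrightarrow> \<bar>p x\<bar> / x powr (\<alpha> - 1) < d"
      unfolding eventually_at_right_field by auto
    show "\<forall>\<^sub>F x in at_right 0. dist (f x / x) 0 < e"
      unfolding eventually_at_right_field
    proof (intro exI[of _ "min b 1"] conjI allI impI)
      fix x assume x: "0 < x" "x < min b 1"
      have pb: "\<bar>p \<tau>\<bar> \<le> d * x powr (\<alpha> - 1)" if "\<tau> \<in> {0..x}" for \<tau>
      proof (cases "\<tau> = 0")
        case False
        then have "\<bar>p \<tau>\<bar> \<le> d * \<tau> powr (\<alpha> - 1)" using b(2)[of \<tau>] that x by (simp add: field_simps)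
        also have "\<dots> \<le> d * x powr (\<alpha> - 1)"
          using that d \<alpha> by (intro mult_left_mono powr_mono2) auto
        finally show ?thesis .
      qed (use p0 d in simp)
      have W: "((\<lambda>\<tau>. (x - \<tau>) powr (1 - \<alpha>) * (d * x powr (\<alpha> - 1))) has_integral
          x powr (2 - \<alpha>) / (2 - \<alpha>) * (d * x powr (\<alpha> - 1))) {0..x}"
        using has_integral_mult_left[OF has_integral_kernel[of x "1 - \<alpha>"]] x \<alpha> by simp
      have "(\<lambda>\<tau>. (x - \<tau>) powr (1 - \<alpha>) * p \<tau>) integrable_on {0..x}"
        by (rule set_borel_integral_eq_integral(1), rule weighted_integrable[OF _ _ kern continuous_on_subset[OF pc]])
          (use x in auto)
      then have "norm (f x) \<le> integral {0..x} (\<lambda>\<tau>. (x - \<tau>) powr (1 - \<alpha>) * (d * x powr (\<alpha> - 1)))"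
        unfolding f_def using W pb
        by (intro integral_norm_bound_integral) (auto simp: abs_mult intro!: mult_left_mono)
      also have "\<dots> = d / (2 - \<alpha>) * (x powr (2 - \<alpha>) * x powr (\<alpha> - 1))"
        using integral_unique[OF W] by simp
      also have "x powr (2 - \<alpha>) * x powr (\<alpha> - 1) = x" using x by (simp flip: powr_add)
      also have "d / (2 - \<alpha>) = e / 2" using \<alpha> by (subst nonzero_divide_eq_eq) (auto simp: d_def)
      finally have "\<bar>f x\<bar> \<le> e / 2 * x" by simp
      then show "dist (f x / x) 0 < e" using x e by (simp add: field_simps) (use mult_pos_pos[OF e x(1)] in linarith)
    qed (use b in auto)
  qed
  from double_antiderivative_eq[OF H taylor this t]
  show ?thesis by (simp add: f_def)
qed

section \<open>Cauchy-Schwarz and log-convex sequences\<close>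

text \<open>For \<open>c > 0\<close> evaluate at the minimiser \<open>- b / c\<close>. Otherwise a
  violation comes from a \<open>t\<close> at which the polynomial equals -1, after the linear term
  has been cancelled by adding the values at \<open>t\<close> and \<open>- t\<close> when
  \<open>c < 0\<close>.\<close>

lemma square_le_of_quadratic_nonneg:
  fixes a b c :: real
  assumes "\<And>t. 0 \<le> a + 2 * t * b + t\<^sup>2 * c"
  shows "b\<^sup>2 \<le> a * c"
proof (cases "c = 0")
  case True
  have "b = 0"
  proof (rule ccontr)
    assume "b \<noteq> 0"
    then have "2 * (- (a + 1) / (2 * b)) * b = - (a + 1)" by simp
    then show False using assms[of "- (a + 1) / (2 * b)"] True by simp
  qed
  then show ?thesis using True by simp
next
  case False
  have "0 \<le> c"
  proof (rule ccontr)
    assume n: "\<not> 0 \<le> c"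
    have "0 \<le> (a + 2 * t * b + t\<^sup>2 * c) + (a + 2 * (- t) * b + (- t)\<^sup>2 * c)" for t
      using assms add_nonneg_nonneg by blast
    then have "0 \<le> 2 * (a + t\<^sup>2 * c)" for t by (simp add: algebra_simps)
    then have *: "0 \<le> a + t\<^sup>2 * c" for t by (metis zero_le_mult_iff zero_less_numeral not_less)
    have "0 \<le> a" using assms[of 0] by simp
    then have "(sqrt ((a + 1) / - c))\<^sup>2 = (a + 1) / - c" using n by (simp add: real_sqrt_pow2_iff divide_nonneg_neg)
    then show False using *[of "sqrt ((a + 1) / - c)"] n by (simp add: field_simps)
  qed
  then have "0 < c" using False by simp
  have "0 \<le> (a + 2 * (- b / c) * b + (- b / c)\<^sup>2 * c) * c"
    using assms[of "- b / c"] \<open>0 < c\<close> by (intro mult_nonneg_nonneg) linarith+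
  also have "\<dots> = a * c - b\<^sup>2" using False by (simp add: field_simps power2_eq_square)
  finally show ?thesis by simp
qed

text \<open>If \<open>\<beta> 1\<close> were positive, all terms would be, and the nondecreasing
  ratios would force \<open>\<beta> n \<ge> \<beta> 0 * r ^ n\<close> with
  \<open>r = \<beta> 1 / \<beta> 0\<close>, against the factorial. Nothing follows for
  \<open>\<beta> 0\<close>, which may be positive with all later terms 0.\<close>

lemma log_convex_superexponential_decay:
  fixes \<beta> :: "nat \<Rightarrow> real"
  assumes nn: "\<And>n. 0 \<le> \<beta> n"
    and lc: "\<And>n. (\<beta> (Suc n))\<^sup>2 \<le> \<beta> n * \<beta> (Suc (Suc n))"
    and dec: "\<And>n. \<beta> n \<le> A * C ^ n / fact n"
  shows "\<beta> 1 = 0"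
proof (rule ccontr)
  assume "\<beta> 1 \<noteq> 0"
  then have p1: "0 < \<beta> 1" using nn[of 1] by linarith
  then have "0 < (\<beta> 1)\<^sup>2" by simp
  also have "\<dots> \<le> \<beta> 0 * \<beta> 2" using lc[of 0] by (simp add: numeral_2_eq_2)
  finally have p0: "0 < \<beta> 0" using nn[of 0] by (cases "\<beta> 0 = 0") auto
  define r where "r = \<beta> 1 / \<beta> 0"
  have r: "0 < r" using p0 p1 by (simp add: r_def)
  have step: "0 < \<beta> n \<and> r * \<beta> n \<le> \<beta> (Suc n)" for n
  proof (induction n)
    case 0
    then show ?case using p0 by (simp add: r_def)
  next
    case (Suc n)
    then have p: "0 < \<beta> (Suc n)" using r by (meson mult_pos_pos less_le_trans)
    have "\<beta> n * (r * \<beta> (Suc n)) \<le> (\<beta> (Suc n))\<^sup>2"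
      using Suc p by (simp add: power2_eq_square mult_ac mult_left_mono)
    also have "\<dots> \<le> \<beta> n * \<beta> (Suc (Suc n))" by (rule lc)
    finally show ?case using p Suc by simp
  qed
  have lower: "\<beta> 0 * r ^ n \<le> \<beta> n" for n
  proof (induction n)
    case (Suc n)
    have "\<beta> 0 * r ^ Suc n \<le> r * \<beta> n" using Suc r by (simp add: mult_ac mult_left_mono)
    then show ?case using step[of n] by linarith
  qed simp
  have "\<beta> 0 \<le> A * ((C / r) ^ n / fact n)" for n
  proof -
    have "\<beta> 0 * r ^ n \<le> A * C ^ n / fact n" using lower[of n] dec[of n] by linarith
    then show ?thesis using r by (simp add: power_divide field_simps)
  qed
  moreover have "(\<lambda>n. A * ((C / r) ^ n / fact n)) \<longlonglongrightarrow> A * 0"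
    using summable_LIMSEQ_zero[OF summable_exp[of "C / r"]]
    by (intro tendsto_mult tendsto_const) (simp add: divide_inverse mult.commute)
  ultimately have "\<beta> 0 \<le> A * 0" by (intro LIMSEQ_le_const) auto
  then show False using p0 by simp
qed

section \<open>Uniqueness\<close>

lemma linear_bound_at_0:
  fixes w wx :: "real \<Rightarrow> real \<Rightarrow> real"
  assumes wx: "continuous_on ({0..1} \<times> {0..1}) (\<lambda>(x, y). wx x y)"
    and d: "\<And>x y. x \<in> {0..1} \<Longrightarrow> y \<in> {0..1} \<Longrightarrow> ((\<lambda>t. w t y) has_real_derivative wx x y) (at x within {0..1})"
    and z: "\<And>y. y \<in> {0..1} \<Longrightarrow> w 0 y = 0"
  obtains M where "\<And>x y. x \<in> {0..1} \<Longrightarrow> y \<in> {0..1} \<Longrightarrow> \<bar>w x y\<bar> \<le> M * x"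
proof -
  have "compact ((\<lambda>(x, y). wx x y) ` ({0..1} \<times> {0..1}))"
    by (intro compact_continuous_image[OF wx] compact_Times) auto
  then obtain M where M: "\<And>x y. x \<in> {0..1} \<Longrightarrow> y \<in> {0..1} \<Longrightarrow> \<bar>wx x y\<bar> \<le> M"
    by (force simp: bounded_iff dest!: compact_imp_bounded)
  have "\<bar>w x y\<bar> \<le> M * x" if "x \<in> {0..1}" "y \<in> {0..1}" for x y
  proof -
    have "norm (w x y - w 0 y) \<le> M * norm (x - 0)"
      by (rule field_differentiable_bound[of "{0..1}" "\<lambda>t. w t y" "\<lambda>t. wx t y"])
        (use d M that in auto)
    then show ?thesis using z that by simp
  qed
  then show thesis by (rule that)
qed

text \<open>The linear bound makes the product \<open>O(x^(a + 1))\<close> uniformly in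
  \<open>y\<close>, hence continuous at \<open>x = 0\<close> with value 0. With
  \<open>a = \<alpha> - 2\<close> it recovers a continuous \<open>u\<close> from the weighted
  function.\<close>

lemma continuous_powr_mult:
  fixes w :: "real \<Rightarrow> real \<Rightarrow> real"
  assumes w: "continuous_on ({0..1} \<times> {0..1}) (\<lambda>(x, y). w x y)"
    and M: "\<And>x y. x \<in> {0..1} \<Longrightarrow> y \<in> {0..1} \<Longrightarrow> \<bar>w x y\<bar> \<le> M * x"
    and a: "- 1 < a"
  shows "continuous_on ({0..1} \<times> {0..1}) (\<lambda>(x, y). x powr a * w x y)"
proof -
  let ?Q = "{0..1::real} \<times> {0..1::real}"
  have "continuous (at z within ?Q) (\<lambda>(x, y). x powr a * w x y)" if z: "z \<in> ?Q" for z
  proof (cases "fst z = 0")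
    case False
    have "continuous (at z within ?Q) (\<lambda>z. fst z powr a)"
      unfolding continuous_within
      by (rule tendsto_powr) (use False in \<open>auto intro!: tendsto_intros\<close>)
    moreover have "continuous (at z within ?Q) (\<lambda>(x, y). w x y)"
      using w z continuous_on_eq_continuous_within by blast
    ultimately have "continuous (at z within ?Q) (\<lambda>z. fst z powr a * (case z of (x, y) \<Rightarrow> w x y))"
      by (rule continuous_mult)
    then show ?thesis by (simp add: case_prod_beta')
  next
    case True
    have "((\<lambda>(x, y). x powr a * w x y) \<longlongrightarrow> 0) (at z within ?Q)"
    proof (rule Lim_null_comparison)
      show "\<forall>\<^sub>F z in at z within ?Q. norm (case z of (x, y) \<Rightarrow> x powr a * w x y) \<le> M * fst z powr (a + 1)"
        unfolding eventually_at_filter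
      proof (intro always_eventually allI impI)
        fix v assume v: "v \<in> ?Q"
        have "fst v powr a * \<bar>w (fst v) (snd v)\<bar> \<le> fst v powr a * (M * fst v)"
          using M[of "fst v" "snd v"] v by (intro mult_left_mono) auto
        also have "\<dots> = M * fst v powr (a + 1)"
        proof (cases "fst v = 0")
          case False
          then show ?thesis using v by (auto simp: powr_add)
        qed simp
        finally show "norm (case v of (x, y) \<Rightarrow> x powr a * w x y) \<le> M * fst v powr (a + 1)"
          by (simp add: case_prod_beta' abs_mult)
      qed
      have "((\<lambda>v. M * fst v powr (a + 1)) \<longlongrightarrow> M * fst z powr (a + 1)) (at z within ?Q)"
      proof (intro tendsto_mult tendsto_const tendsto_powr')
        have "\<forall>\<^sub>F x in at z within ?Q. 0 \<le> fst x"
          unfolding eventually_at_filter by (intro always_eventually) auto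
        then show "fst z \<noteq> 0 \<or> 0 < a + 1 \<and> (\<forall>\<^sub>F x in at z within ?Q. 0 \<le> fst x)"
          using a by simp
      qed (auto intro: tendsto_intros)
      then show "((\<lambda>v. M * fst v powr (a + 1)) \<longlongrightarrow> 0) (at z within ?Q)"
        using True by simp
    qed
    then show ?thesis using True by (simp add: continuous_within case_prod_beta')
  qed
  then show ?thesis by (simp add: continuous_on_eq_continuous_within)
qed

text \<open>Membership in the clamped class makes the weighted right-hand side continuous, so the
  next equation is solvable within the same class. The sign stays on the right because
  \<open>(- 1) ^ k\<close> is its own inverse.\<close>

lemma exists_iterated_resolvent:
  fixes e0 :: "nat \<Rightarrow> real \<Rightarrow> real"
  assumes k: "0 < k" and m: "m < real k" and e0: "clamped k e0"
  obtains e where "e 0 = e0" "\<And>n. clamped k (e n)"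
    "\<And>n y. y \<in> {0..1} \<Longrightarrow> e (Suc n) (2 * k) y = (- 1) ^ k * (y powr (- m) * e n 0 y)"
proof -
  have "\<exists>e. \<forall>n. (clamped k (e n) \<and> (n = 0 \<longrightarrow> e n = e0)) \<and>
     (\<forall>y\<in>{0..1}. e (Suc n) (2 * k) y = (- 1) ^ k * (y powr (- m) * e n 0 y))"
  proof (rule dependent_nat_choice)
    show "\<exists>x. clamped k x \<and> (0 = (0::nat) \<longrightarrow> x = e0)" using e0 by blast
    fix x and n :: nat
    assume "clamped k x \<and> (n = 0 \<longrightarrow> x = e0)"
    then have "continuous_on {0..1} (\<lambda>y. (- 1) ^ k * (y powr (- m) * x 0 y))"
      by (intro continuous_on_mult continuous_on_const clamped_weight_continuous[OF _ m]) auto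
    from clamped_exists[OF k this]
    show "\<exists>y. (clamped k y \<and> (Suc n = 0 \<longrightarrow> y = e0)) \<and>
        (\<forall>z\<in>{0..1}. y (2 * k) z = (- 1) ^ k * (z powr (- m) * x 0 z))" by auto
  qed
  then show thesis using that by blast
qed

text \<open>Phrased for \<open>w\<close>, the extension of
  \<open>x powr (2 - \<alpha>) * u x y\<close>, so that everything is defined at
  \<open>x = 0\<close>. \<open>\<Phi>\<close> is the second derivative of the Abel integral without
  its Gamma factor, which is carried by \<open>c\<close>.\<close>

lemma weighted_solution_eq_zero:
  fixes w wx \<Phi> V :: "real \<Rightarrow> real \<Rightarrow> real"
  assumes k: "1 \<le> k" and \<alpha>: "1 < \<alpha>" "\<alpha> < 2" and m: "m < real k" and c: "0 < c"
    and w: "continuous_on ({0..1} \<times> {0..1}) (\<lambda>(x, y). w x y)"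
    and wx: "continuous_on ({0..1} \<times> {0..1}) (\<lambda>(x, y). wx x y)"
    and d: "\<And>x y. x \<in> {0..1} \<Longrightarrow> y \<in> {0..1} \<Longrightarrow> ((\<lambda>t. w t y) has_real_derivative wx x y) (at x within {0..1})"
    and z: "\<And>y. y \<in> {0..1} \<Longrightarrow> w 0 y = 0" and zx: "\<And>y. y \<in> {0..1} \<Longrightarrow> wx 0 y = 0"
    and RL: "\<And>x y. x \<in> {0<..<1} \<Longrightarrow> y \<in> {0..1} \<Longrightarrow>
        has_nth_deriv 2 (\<lambda>t. integral {0..t} (\<lambda>\<tau>. (t - \<tau>) powr (1 - \<alpha>) * (\<tau> powr (\<alpha> - 2) * w \<tau> y))) UNIV x (\<Phi> x y)"
    and \<Phi>: "continuous_on ({0<..<1} \<times> {0..1}) (\<lambda>(x, y). \<Phi> x y)"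
    and V: "\<And>x y. x \<in> {0<..<1} \<Longrightarrow> y \<in> {0..1} \<Longrightarrow>
        has_nth_deriv (2 * k) (\<lambda>y. x powr (\<alpha> - 2) * w x y) {0..1} y (V x y)"
    and Vc: "\<And>x. x \<in> {0<..<1} \<Longrightarrow> continuous_on {0..1} (V x)"
    and bc: "\<And>x s. x \<in> {0<..<1} \<Longrightarrow> s < k \<Longrightarrow>
        has_nth_deriv s (\<lambda>y. x powr (\<alpha> - 2) * w x y) {0..1} 0 0 \<and>
        has_nth_deriv s (\<lambda>y. x powr (\<alpha> - 2) * w x y) {0..1} 1 0"
    and pde: "\<And>x y. x \<in> {0<..<1} \<Longrightarrow> y \<in> {0<..<1} \<Longrightarrow> (- 1) ^ (k + 1) * (c * \<Phi> x y) = y powr m * V x y"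
    and x0: "x0 \<in> {0<..<1}" and y0: "y0 \<in> {0..1}"
  shows "w x0 y0 = 0"
proof -
  define U where "U x y = x powr (\<alpha> - 2) * w x y" for x y
  obtain M where M: "\<And>x y. x \<in> {0..1} \<Longrightarrow> y \<in> {0..1} \<Longrightarrow> \<bar>w x y\<bar> \<le> M * x"
    using linear_bound_at_0[OF wx d z] by blast
  have U: "continuous_on ({0..1} \<times> {0..1}) (\<lambda>(x, y). U x y)"
    unfolding U_def by (rule continuous_powr_mult[OF w M]) (use \<alpha> in auto)
  have "\<exists>D. clamped k D \<and> (\<forall>y\<in>{0..1}. D 0 y = U x y) \<and> (\<forall>y\<in>{0..1}. D (2 * k) y = V x y)"
    if x: "x \<in> {0<..<1}" for x
    using has_nth_deriv_clamped[of k "\<lambda>y. x powr (\<alpha> - 2) * w x y" "V x", OF V[OF x] Vc[OF x] bc[OF x]]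
    unfolding U_def by metis
  then obtain D where D: "\<And>x. x \<in> {0<..<1} \<Longrightarrow> clamped k (D x)"
      and D0: "\<And>x y. x \<in> {0<..<1} \<Longrightarrow> y \<in> {0..1} \<Longrightarrow> D x 0 y = U x y"
      and D2: "\<And>x y. x \<in> {0<..<1} \<Longrightarrow> y \<in> {0..1} \<Longrightarrow> D x (2 * k) y = V x y"
    by metis
  obtain e where e0: "e 0 = D x0" and e: "\<And>n. clamped k (e n)"
    and eS: "\<And>n y. y \<in> {0..1} \<Longrightarrow> e (Suc n) (2 * k) y = (- 1) ^ k * (y powr (- m) * e n 0 y)"
    using exists_iterated_resolvent[OF _ m D[OF x0]] k by auto
  \<comment> \<open>With the weight absorbed into \<open>E n\<close>, a plain integral against
    \<open>E n\<close> is the weighted inner product with \<open>e n 0\<close>.\<close>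
  define E where "E n y = y powr (- m) * e n 0 y" for n y
  have E: "continuous_on {0..1} (E n)" for n
    unfolding E_def by (rule clamped_weight_continuous[OF e m])
  have sgn: "((- 1) ^ k * (- 1) ^ k :: real) = 1" by (simp flip: power_mult_distrib)
  have Ee: "E n y = (- 1) ^ k * e (Suc n) (2 * k) y" if "y \<in> {0..1}" for n y
    using sgn by (simp only: eS[OF that] E_def mult.assoc[symmetric] mult_1_left)
  have ec: "continuous_on {0..1} (e n 0)" for n by (rule clamped_continuous[OF e]) simp

  define p where "p n x = integral {0..1} (\<lambda>y. U x y * E n y)" for n x
  have pc: "continuous_on {0..1} (p n)" for n
    unfolding p_def[abs_def]
    using integral_continuous_on_param[of "{0..1}" 0 1 "\<lambda>x y. U x y * E n y"] continuous_on_mult_snd[OF U E]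
    by (simp add: cbox_interval)
  have p0: "p n 0 = 0" for n by (simp add: p_def U_def)
  \<comment> \<open>\<open>E n\<close> is, up to sign, the \<open>2k\<close>-th derivative of
    \<open>e (Suc n) 0\<close>; integration by parts moves it onto \<open>U x\<close>, where the
    equation replaces it by \<open>\<Phi>\<close>.\<close>
  have p\<Phi>: "- (1 / c) * p n x = integral {0..1} (\<lambda>y. \<Phi> x y * E (Suc n) y)" if x: "x \<in> {0<..<1}" for n x
  proof -
    have "p n x = integral {0..1} (\<lambda>y. (- 1) ^ k * (D x 0 y * e (Suc n) (2 * k) y))"
      unfolding p_def
      by (rule Henstock_Kurzweil_Integration.integral_cong)
        (simp add: D0[OF x] Ee mult.left_commute)
    also have "\<dots> = (- 1) ^ k * integral {0..1} (\<lambda>y. D x (2 * k) y * e (Suc n) 0 y)"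
      by (simp add: clamped_by_parts[OF D[OF x] e])
    also have "\<dots> = integral {0..1} (\<lambda>y. (- 1) ^ k * (D x (2 * k) y * e (Suc n) 0 y))"
      by simp
    also have "\<dots> = integral {0..1} (\<lambda>y. - c * (\<Phi> x y * E (Suc n) y))"
    proof (rule Henstock_Kurzweil_Integration.integral_cong)
      fix y :: real assume y: "y \<in> {0..1}"
      show "(- 1) ^ k * (D x (2 * k) y * e (Suc n) 0 y) = - c * (\<Phi> x y * E (Suc n) y)"
      proof (cases "y = 0 \<or> y = 1")
        case True
        then have "e (Suc n) 0 y = 0" using e[of "Suc n"] k by (auto simp: clamped_def)
        then show ?thesis by (simp add: E_def)
      next
        case False
        then have y': "y \<in> {0<..<1}" using y by auto
        have "D x (2 * k) y = y powr (- m) * (y powr m * V x y)"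
          using y' by (simp add: D2[OF x y] powr_minus)
        also have "\<dots> = y powr (- m) * ((- 1) ^ (k + 1) * (c * \<Phi> x y))"
          by (simp only: pde[OF x y'])
        finally have "(- 1) ^ k * (D x (2 * k) y * e (Suc n) 0 y)
            = ((- 1) ^ k * (- 1) ^ k) * (- c * (\<Phi> x y * E (Suc n) y))"
          by (simp add: E_def algebra_simps)
        then show ?thesis by (simp add: sgn)
      qed
    qed
    also have "\<dots> = - c * integral {0..1} (\<lambda>y. \<Phi> x y * E (Suc n) y)" by simp
    finally show ?thesis using c by simp
  qed
  have lim: "((\<lambda>x. p n x / x powr (\<alpha> - 1)) \<longlongrightarrow> 0) (at_right 0)" for n
  proof -
    \<comment> \<open>Moments of the \<open>C^1\<close> function \<open>w\<close>: both
      \<open>W\<close> and its derivative vanish at 0, so \<open>W x = o(x)\<close>, and the factor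
      \<open>x powr (\<alpha> - 2)\<close> turns this into the claim for \<open>p n\<close>.\<close>
    define W where "W x = integral (cbox 0 1) (\<lambda>y. w x y * E n y)" for x
    have "(W has_field_derivative integral (cbox 0 1) (\<lambda>y. wx 0 y * E n y)) (at 0 within {0..1})"
      unfolding W_def
    proof (rule leibniz_rule_field_derivative)
      show "((\<lambda>x. w x y * E n y) has_field_derivative wx x y * E n y) (at x within {0..1})"
        if "x \<in> {0..1}" "y \<in> cbox 0 1" for x y
        using d[of x y] that by (intro DERIV_cmult_right) simp
      show "(\<lambda>y. w x y * E n y) integrable_on cbox 0 1" if "x \<in> {0..1}" for x
        using that by (intro integrable_continuous continuous_on_mult) (auto simp: E continuous_on_slice[OF w])
      show "continuous_on ({0..1} \<times> cbox 0 1) (\<lambda>(x, t). wx x t * E n t)"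
        using continuous_on_mult_snd[OF wx E] by simp
    qed auto
    moreover have "integral (cbox 0 1) (\<lambda>y. wx 0 y * E n y) = integral (cbox 0 1) (\<lambda>y::real. 0)"
      by (rule Henstock_Kurzweil_Integration.integral_cong) (simp add: zx)
    moreover have "W 0 = integral (cbox 0 1) (\<lambda>y::real. 0)"
      unfolding W_def by (rule Henstock_Kurzweil_Integration.integral_cong) (simp add: z)
    ultimately have "((\<lambda>x. W x / x) \<longlongrightarrow> 0) (at 0 within {0..1})"
      by (simp add: has_field_derivative_iff)
    then have "((\<lambda>x. W x / x) \<longlongrightarrow> 0) (at_right 0)" by (simp add: at_within_Icc_at_right)
    moreover have "\<forall>\<^sub>F x in at_right 0. W x / x = p n x / x powr (\<alpha> - 1)"
      using eventually_at_right_less[of 0]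
    proof eventually_elim
      fix x :: real assume x: "0 < x"
      have "p n x = x powr (\<alpha> - 2) * W x"
        by (simp add: p_def U_def W_def mult.assoc)
      moreover have "x powr (\<alpha> - 1) = x powr (\<alpha> - 2) * x"
        using x powr_add[of x "\<alpha> - 2" 1] by simp
      ultimately show "W x / x = p n x / x powr (\<alpha> - 1)" using x by simp
    qed
    ultimately show ?thesis by (rule Lim_transform_eventually)
  qed
  define B where "B = Beta (2 - \<alpha>) (\<alpha> - 1)"
  have B: "0 < B" using \<alpha> by (simp add: B_def Beta_def Gamma_real_pos)
  obtain A where A: "\<And>x. x \<in> {0..1} \<Longrightarrow> \<bar>p 0 x\<bar> \<le> A"
  proof -
    have "compact (p 0 ` {0..1})" by (intro compact_continuous_image[OF pc]) simp
    then show thesis using that by (force simp: bounded_iff dest!: compact_imp_bounded)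
  qed
  \<comment> \<open>The cost of one passage from \<open>p n\<close> to \<open>p (Suc n)\<close>:
    \<open>1 / c\<close> from the equation and \<open>1 / (B * (\<alpha> - 1))\<close> from
    \<open>abel_bound\<close>, whose factor \<open>x powr (\<alpha> - 1)\<close> is estimated by 1.
    The power of \<open>x\<close> and the factorial come from integrating
    \<open>s ^ n\<close>.\<close>
  define C where "C = 1 / (c * B * (\<alpha> - 1))"
  have C: "0 < C" using c B \<alpha> by (simp add: C_def)
  have A0: "0 \<le> A" using A[of 0] by simp
  have bound: "\<forall>x\<in>{0..<1}. \<bar>p n x\<bar> \<le> A * C ^ n * x ^ n / fact n" for n
  proof (induction n)
    case 0
    then show ?case using A by simp
  next
    case (Suc n)
    show ?case
    proof
      fix x :: real assume "x \<in> {0..<1}"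
      then consider "x = 0" | "0 < x" "x < 1" by fastforce
      then show "\<bar>p (Suc n) x\<bar> \<le> A * C ^ Suc n * x ^ Suc n / fact (Suc n)"
      proof cases
        case 1
        then show ?thesis by (simp add: p0)
      next
        case 2
        \<comment> \<open>By \<open>p\<Phi>\<close> this is the moment of \<open>\<Phi>\<close>
          inside \<open>(0, 1)\<close>; in this form it is continuous on the closed
          interval.\<close>
        define H where "H s = - (1 / c) * p n s" for s
        define L where "L = (1 / c) * (A * C ^ n / fact n) * (x ^ Suc n / Suc n)"
        have L0: "0 \<le> L" using A0 C c 2 by (simp add: L_def)
        have H: "continuous_on {0..1} H" unfolding H_def by (intro continuous_intros pc)
        have sub: "{0..x} \<subseteq> {0..1}" using 2 by auto
        have "B * \<bar>p (Suc n) x\<bar> \<le> L * x powr (\<alpha> - 1) / (\<alpha> - 1)"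
          unfolding B_def
        proof (rule abel_bound[OF \<alpha> 2(1) continuous_on_subset[OF pc sub] continuous_on_subset[OF H sub]])
          fix t assume t: "t \<in> {0..<x}"
          show "integral {0..t} (\<lambda>\<tau>. (t - \<tau>) powr (1 - \<alpha>) * p (Suc n) \<tau>) = integral {0..t} (\<lambda>s. (t - s) * H s)"
          proof (cases "t = 0")
            case False
            show ?thesis
              by (rule fractional_moment[OF \<alpha> U _ \<Phi> E H _ p_def p0 lim])
                (use RL[folded U_def] p\<Phi>[of _ n] False t 2 in \<open>auto simp: H_def\<close>)
          qed simp
        next
          fix t assume t: "t \<in> {0..x}"
          have i: "((\<lambda>s. (1 / c) * (A * C ^ n / fact n) * s ^ n) has_integral
              (1 / c) * (A * C ^ n / fact n) * (t ^ Suc n / Suc n)) {0..t}"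
          proof (rule has_integral_mult_right)
            have "((\<lambda>s. s ^ n) has_integral (t ^ Suc n / Suc n - 0 ^ Suc n / Suc n)) {0..t}"
            proof (rule fundamental_theorem_of_calculus)
              fix s :: real
              have "((\<lambda>s. s ^ Suc n / Suc n) has_real_derivative s ^ n) (at s within {0..t})"
                using DERIV_cdivide[OF DERIV_pow[of "Suc n" s "{0..t}"], of "Suc n"]
                by (simp del: power_Suc)
              then show "((\<lambda>s. s ^ Suc n / Suc n) has_vector_derivative s ^ n) (at s within {0..t})"
                by (simp only: has_real_derivative_iff_has_vector_derivative)
            qed (use t in simp)
            then show "((\<lambda>s. s ^ n) has_integral t ^ Suc n / Suc n) {0..t}" by simp
          qed
          have "norm (integral {0..t} H) \<le> integral {0..t} (\<lambda>s. (1 / c) * (A * C ^ n / fact n) * s ^ n)"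
          proof (rule integral_norm_bound_integral)
            show "H integrable_on {0..t}"
              by (rule integrable_continuous_real, rule continuous_on_subset[OF H]) (use t 2 in auto)
            fix s assume "s \<in> {0..t}"
            then have "\<bar>p n s\<bar> \<le> (A * C ^ n / fact n) * s ^ n" using Suc t 2 by simp
            from mult_left_mono[OF this, of "1 / c"]
            show "norm (H s) \<le> (1 / c) * (A * C ^ n / fact n) * s ^ n"
              using c by (simp add: H_def abs_mult)
          qed (use i in auto)
          also have "\<dots> = (1 / c) * (A * C ^ n / fact n) * (t ^ Suc n / Suc n)"
            by (rule integral_unique[OF i])
          also have "\<dots> \<le> L"
            unfolding L_def using t A0 C c
            by (intro mult_left_mono divide_right_mono power_mono) auto
          finally show "\<bar>integral {0..t} H\<bar> \<le> L" by simp
        qed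
        also have "\<dots> \<le> L * 1 / (\<alpha> - 1)"
          using 2 \<alpha> L0 powr_mono2[of "\<alpha> - 1" x 1]
          by (intro divide_right_mono mult_left_mono) auto
        finally have "\<bar>p (Suc n) x\<bar> \<le> L / (\<alpha> - 1) / B"
          by (simp only: pos_le_divide_eq[OF B] mult.commute mult_1_right)
        also have "\<dots> = C * (A * C ^ n * x ^ Suc n / (fact n * Suc n))"
          by (simp add: C_def L_def del: of_nat_Suc) (simp add: algebra_simps)
        also have "\<dots> = A * C ^ Suc n * x ^ Suc n / fact (Suc n)"
          by (simp add: mult_ac distrib_left)
        finally show ?thesis .
      qed
    qed
  qed

  define ip where "ip i j = integral {0..1} (\<lambda>y. e i 0 y * E j y)" for i j
  have ipi: "(\<lambda>y. e i 0 y * E j y) integrable_on {0..1}" for i j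
    by (intro integrable_continuous_real continuous_on_mult ec E)
  have ip_sym: "ip i j = ip j i" for i j
    unfolding ip_def by (simp add: E_def mult_ac)
  \<comment> \<open>Both sides pair \<open>e (Suc i)\<close> with \<open>e (Suc j)\<close> after one
    application of \<open>L\<close>, to the first on the left and to the second on the
    right.\<close>
  have shift: "ip i (Suc j) = ip (Suc i) j" for i j
  proof -
    have *: "ip i j = (- 1) ^ k * integral {0..1} (\<lambda>y. e i 0 y * e (Suc j) (2 * k) y)" for i j
    proof -
      have "ip i j = integral {0..1} (\<lambda>y. (- 1) ^ k * (e i 0 y * e (Suc j) (2 * k) y))"
        unfolding ip_def
        by (rule Henstock_Kurzweil_Integration.integral_cong)
          (simp add: Ee mult.left_commute)
      then show ?thesis by simp
    qed
    have "ip i (Suc j) = ip (Suc j) i" by (rule ip_sym)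
    also have "\<dots> = (- 1) ^ k * integral {0..1} (\<lambda>y. e (Suc j) (2 * k) y * e (Suc i) 0 y)"
      unfolding * by (simp add: clamped_by_parts[OF e e])
    also have "\<dots> = ip (Suc i) j" unfolding * by (simp add: mult.commute)
    finally show ?thesis .
  qed
  have ip_add: "ip i j = ip 0 (i + j)" for i j
  proof (induction i arbitrary: j)
    case (Suc i)
    then show ?case using shift[of i j] by simp
  qed simp
  have ip_p: "ip 0 n = p n x0" for n
    unfolding ip_def p_def
    by (rule Henstock_Kurzweil_Integration.integral_cong) (simp add: e0 D0[OF x0])
  have ip_nn: "0 \<le> ip i i" for i
    unfolding ip_def
    by (rule integral_nonneg[OF ipi]) (simp add: E_def mult.left_commute[of _ "_ powr _"])
  have cs: "(ip i j)\<^sup>2 \<le> ip i i * ip j j" for i j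
  proof (rule square_le_of_quadratic_nonneg)
    fix t :: real
    have "0 \<le> integral {0..1} (\<lambda>y. e i 0 y * E i y + 2 * t * (e i 0 y * E j y) + t\<^sup>2 * (e j 0 y * E j y))"
    proof (rule integral_nonneg)
      show "(\<lambda>y. e i 0 y * E i y + 2 * t * (e i 0 y * E j y) + t\<^sup>2 * (e j 0 y * E j y)) integrable_on {0..1}"
        by (intro integrable_add integrable_on_mult_right ipi)
      fix y :: real
      have "e i 0 y * E i y + 2 * t * (e i 0 y * E j y) + t\<^sup>2 * (e j 0 y * E j y)
          = y powr (- m) * (e i 0 y + t * e j 0 y)\<^sup>2"
        by (simp add: E_def power2_eq_square algebra_simps)
      then show "0 \<le> e i 0 y * E i y + 2 * t * (e i 0 y * E j y) + t\<^sup>2 * (e j 0 y * E j y)" by simp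
    qed
    also have "\<dots> = ip i i + 2 * t * ip i j + t\<^sup>2 * ip j j"
      unfolding ip_def by (simp add: integral_add integrable_add integrable_on_mult_right ipi)
    finally show "0 \<le> ip i i + 2 * t * ip i j + t\<^sup>2 * ip j j" .
  qed
  have ip11: "ip 1 1 = 0"
  proof (rule log_convex_superexponential_decay[of "\<lambda>n. ip n n" A "C\<^sup>2"])
    show "0 \<le> ip n n" for n by (rule ip_nn)
    show "(ip (Suc n) (Suc n))\<^sup>2 \<le> ip n n * ip (Suc (Suc n)) (Suc (Suc n))" for n
      \<comment> \<open>Indices with equal sum give equal products, so the mixed term for
        \<open>n\<close> and \<open>n + 2\<close> is the diagonal term for
        \<open>n + 1\<close>.\<close>
      using cs[of n "Suc (Suc n)"] ip_add[of n "Suc (Suc n)"] ip_add[of "Suc n" "Suc n"] by simp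
    fix n
    have "ip n n \<le> A * C ^ (2 * n) * x0 ^ (2 * n) / fact (2 * n)"
      using bound[of "2 * n"] x0 ip_add[of n n] ip_p[of "2 * n"] by (simp add: mult_2 abs_le_iff)
    \<comment> \<open>Since \<open>x0 < 1\<close> its power is dropped, and \<open>(2n)!\<close> is
      estimated from below by \<open>n!\<close>.\<close>
    also have "\<dots> \<le> A * C ^ (2 * n) * 1 / fact n"
      using x0 A0 C by (intro frac_le mult_left_mono power_le_one fact_mono) auto
    finally show "ip n n \<le> A * (C\<^sup>2) ^ n / fact n" by (simp add: power_mult)
  qed
  have ip_zero: "e i 0 y = 0" if "ip i i = 0" "y \<in> {0..1}" for i y
  proof (cases "y = 0")
    \<comment> \<open>Here \<open>0 powr (- m) = 0\<close>, so the integrand carries no information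
      and the boundary condition is used instead.\<close>
    case True
    then show ?thesis using e[of i] k by (auto simp: clamped_def)
  next
    case False
    have "continuous_on {0..1} (\<lambda>y. e i 0 y * E i y)" by (intro continuous_on_mult ec E)
    moreover have "0 \<le> e i 0 y * E i y" for y by (simp add: E_def mult.left_commute[of _ "_ powr _"])
    ultimately have "\<forall>y\<in>{0..1}. e i 0 y * E i y = 0"
      using that(1) unfolding ip_def by (subst (asm) integral_eq_0_iff) auto
    then show ?thesis using that False by (auto simp: E_def)
  qed
  have e1: "e 1 0 y = 0" if "y \<in> {0..1}" for y using ip_zero[OF ip11 that] .
  \<comment> \<open>The derivatives fall on \<open>e 0\<close>, so that only the vanishing of
    \<open>e 1 0\<close> itself is used, not that of its \<open>2k\<close>-th derivative.\<close>
  have "ip 0 0 = integral {0..1} (\<lambda>y. (- 1) ^ k * (e 0 0 y * e 1 (2 * k) y))"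
    unfolding ip_def
    by (rule Henstock_Kurzweil_Integration.integral_cong)
      (simp add: Ee mult.left_commute)
  also have "\<dots> = (- 1) ^ k * integral {0..1} (\<lambda>y. e 0 (2 * k) y * e 1 0 y)"
    by (simp add: clamped_by_parts[OF e e])
  also have "integral {0..1} (\<lambda>y. e 0 (2 * k) y * e 1 0 y) = integral {0..1} (\<lambda>y::real. 0 :: real)"
    by (rule Henstock_Kurzweil_Integration.integral_cong) (simp only: e1 mult_zero_right)
  finally have "ip 0 0 = 0" by simp
  from ip_zero[OF this y0] have "U x0 y0 = 0" by (simp add: e0 D0[OF x0 y0])
  then show ?thesis using x0 by (simp add: U_def)
qed

section \<open>From solutions of Problem A to weighted functions\<close>

text \<open>Continuity of \<open>w\<close> and \<open>wx\<close> up to \<open>x = 0\<close>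
  identifies their boundary values with the prescribed limits; inside \<open>(0, 1)\<close> the
  one-sided derivative \<open>wx\<close> is the two-sided \<open>deriv\<close> of the initial
  condition.\<close>

lemma weighted_trace_data:
  fixes w wx u :: "real \<Rightarrow> real \<Rightarrow> real"
  assumes w: "continuous_on ({0..1} \<times> {0..1}) (\<lambda>(x, y). w x y)"
    and wx: "continuous_on ({0..1} \<times> {0..1}) (\<lambda>(x, y). wx x y)"
    and d: "\<And>x y. x \<in> {0..1} \<Longrightarrow> y \<in> {0..1} \<Longrightarrow> ((\<lambda>t. w t y) has_real_derivative wx x y) (at x within {0..1})"
    and wu: "\<And>x y. x \<in> {0<..1} \<Longrightarrow> y \<in> {0..1} \<Longrightarrow> w x y = x powr (2 - \<alpha>) * u x y"
    and y: "y \<in> {0..1}"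
    and \<psi>: "((\<lambda>x. x powr (2 - \<alpha>) * u x y) \<longlongrightarrow> \<psi>) (at_right 0)"
    and \<phi>: "((\<lambda>x. deriv (\<lambda>t. t powr (2 - \<alpha>) * u t y) x) \<longlongrightarrow> \<phi>) (at_right 0)"
  shows "w 0 y = \<psi>" "wx 0 y = \<phi>"
proof -
  have slice: "((\<lambda>x. f x y) \<longlongrightarrow> f 0 y) (at_right 0)"
    if f: "continuous_on ({0..1} \<times> {0..1}) (\<lambda>(x, y). f x y)" for f :: "real \<Rightarrow> real \<Rightarrow> real"
  proof -
    have "continuous_on {0..1} (\<lambda>x. (\<lambda>(x, y). f x y) (x, y))"
      by (rule continuous_on_compose2[OF f]) (use y in \<open>auto intro!: continuous_intros\<close>)
    then have "((\<lambda>x. f x y) \<longlongrightarrow> f 0 y) (at 0 within {0..1})"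
      by (simp add: continuous_on_def)
    then show ?thesis by (simp add: at_within_Icc_at_right)
  qed
  have near: "\<forall>\<^sub>F x in at_right 0. x \<in> {0<..<1::real}"
    unfolding eventually_at_right_field by (intro exI[of _ 1]) auto
  have "\<forall>\<^sub>F x in at_right 0. w x y = x powr (2 - \<alpha>) * u x y"
    using near by eventually_elim (use wu y in auto)
  from tendsto_unique[OF _ Lim_transform_eventually[OF slice[OF w] this] \<psi>]
  show "w 0 y = \<psi>" by simp
  have "\<forall>\<^sub>F x in at_right 0. wx x y = deriv (\<lambda>t. t powr (2 - \<alpha>) * u t y) x"
    using near
  proof eventually_elim
    fix x :: real assume x: "x \<in> {0<..<1}"
    have "((\<lambda>t. w t y) has_real_derivative wx x y) (at x)"
      using d[of x y] x y at_within_Icc_at[of 0 x 1] by simp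
    then have "((\<lambda>t. t powr (2 - \<alpha>) * u t y) has_real_derivative wx x y) (at x)"
      by (rule has_field_derivative_transform_within_open[where S = "{0<..<1}"]) (use x y wu in auto)
    then show "wx x y = deriv (\<lambda>t. t powr (2 - \<alpha>) * u t y) x" by (simp add: DERIV_imp_deriv)
  qed
  from tendsto_unique[OF _ Lim_transform_eventually[OF slice[OF wx] this] \<phi>]
  show "wx 0 y = \<phi>" by simp
qed

text \<open>A single solution need not vanish at \<open>x = 0\<close>, so both singularities remain,
  and their product is a Beta integrand. Existence is part of the claim: the total function
  \<open>integral\<close> is additive only on integrable functions, and two solutions are subtracted
  later.\<close>

lemma RL_integral_eq:
  fixes w u :: "real \<Rightarrow> real \<Rightarrow> real"
  assumes \<alpha>: "1 < \<alpha>" "\<alpha> < 2" and w: "continuous_on ({0..1} \<times> {0..1}) (\<lambda>(x, y). w x y)"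
    and wu: "\<And>x y. x \<in> {0<..1} \<Longrightarrow> y \<in> {0..1} \<Longrightarrow> w x y = x powr (2 - \<alpha>) * u x y"
    and y: "y \<in> {0..1}" and t: "t \<in> {0<..<1}"
  shows "((\<lambda>\<tau>. (t - \<tau>) powr (1 - \<alpha>) * (\<tau> powr (\<alpha> - 2) * w \<tau> y)) has_integral
     integral {0..t} (\<lambda>\<tau>. u \<tau> y / (t - \<tau>) powr (\<alpha> - 1))) {0..t}"
proof -
  let ?f = "\<lambda>\<tau>. (t - \<tau>) powr (1 - \<alpha>) * (\<tau> powr (\<alpha> - 2) * w \<tau> y)"
  have "continuous_on {0..1} (\<lambda>x. (\<lambda>(x, y). w x y) (x, y))"
    by (rule continuous_on_compose2[OF w]) (use y in \<open>auto intro!: continuous_intros\<close>)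
  then have "continuous_on {0..1} (\<lambda>\<tau>. w \<tau> y)" by simp
  then have wc: "continuous_on {0..t} (\<lambda>\<tau>. w \<tau> y)"
    by (rule continuous_on_subset) (use t in auto)
  have "(\<lambda>\<tau>. (t - \<tau>) powr (1 - \<alpha>) * \<tau> powr (\<alpha> - 2)) integrable_on {0..t}"
    using has_integral_beta_interval[of "\<alpha> - 1" "2 - \<alpha>" 0 t] \<alpha> t by auto
  from weighted_integrable[OF _ _ this wc]
  have "?f integrable_on {0..t}"
    using set_borel_integral_eq_integral(1) by (fastforce simp: mult.assoc)
  moreover have "integral {0..t} (\<lambda>\<tau>. u \<tau> y / (t - \<tau>) powr (\<alpha> - 1)) = integral {0..t} ?f"
  \<comment> \<open>At \<open>\<tau> = 0\<close> the extension \<open>w\<close> and the function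
    \<open>u\<close> are unrelated. At \<open>\<tau> = t\<close> both sides are 0, as
    \<open>0 powr _ = 0\<close> and division by 0 gives 0.\<close>
  proof (rule integral_spike[of "{0}"])
    fix \<tau> assume \<tau>: "\<tau> \<in> {0..t} - {0}"
    have "\<tau> powr (\<alpha> - 2) * \<tau> powr (2 - \<alpha>) = 1" using \<tau> by (simp flip: powr_add)
    then have "\<tau> powr (\<alpha> - 2) * w \<tau> y = u \<tau> y"
      using \<tau> t y by (simp add: wu mult.assoc[symmetric])
    moreover have "(t - \<tau>) powr (1 - \<alpha>) = inverse ((t - \<tau>) powr (\<alpha> - 1))"
      by (simp flip: powr_minus)
    ultimately show "?f \<tau> = u \<tau> y / (t - \<tau>) powr (\<alpha> - 1)" by (simp add: field_simps)
  qed simp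
  ultimately show ?thesis by (simp only: integrable_integral)
qed

lemma solves_problem_A_elim:
  assumes "solves_problem_A k \<alpha> m \<phi> \<psi> u"
  obtains Du V w wx wy where
    "\<forall>x\<in>{0<..<1}. \<forall>y\<in>{0..1}. has_RL_deriv \<alpha> (\<lambda>t. u t y) x (Du x y)"
    "continuous_on ({0<..<1} \<times> {0..1}) (\<lambda>(x, y). Du x y)"
    "\<forall>x\<in>{0<..<1}. \<forall>y\<in>{0..1}. has_nth_deriv (2 * k) (u x) {0..1} y (V x y)"
    "continuous_on ({0<..<1} \<times> {0..1}) (\<lambda>(x, y). V x y)"
    "\<forall>x\<in>{0<..<1}. \<forall>y\<in>{0<..<1}. (- 1) ^ (k + 1) * Du x y - y powr m * V x y = 0"
    "continuous_on ({0..1} \<times> {0..1}) (\<lambda>(x, y). w x y)"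
    "continuous_on ({0..1} \<times> {0..1}) (\<lambda>(x, y). wx x y)"
    "\<forall>x\<in>{0..1}. \<forall>y\<in>{0..1}.
       ((\<lambda>t. w t y) has_real_derivative wx x y) (at x within {0..1}) \<and>
       ((\<lambda>t. w x t) has_real_derivative wy x y) (at y within {0..1})"
    "\<forall>x\<in>{0<..1}. \<forall>y\<in>{0..1}. w x y = x powr (2 - \<alpha>) * u x y"
    "\<forall>x\<in>{0<..1}. \<forall>s<k. has_nth_deriv s (u x) {0..1} 0 0 \<and> has_nth_deriv s (u x) {0..1} 1 0"
    "\<forall>y\<in>{0..1}. ((\<lambda>x. x powr (2 - \<alpha>) * u x y) \<longlongrightarrow> \<psi> y) (at_right 0) \<and>
       ((\<lambda>x. deriv (\<lambda>t. t powr (2 - \<alpha>) * u t y) x) \<longlongrightarrow> \<phi> y) (at_right 0)"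
  using assms unfolding solves_problem_A_def C1_closed_square_def
  apply (elim conjE exE)
  subgoal for Du w V wx wy by (rule that[of Du V w wx wy]; assumption)
  done

text \<open>Equal data give equal traces of the two extensions, so their difference has zero trace
  and zero \<open>x\<close>-derivative at \<open>x = 0\<close>, and the homogeneous case applies.
  \<open>Gamma (2 - \<alpha>)\<close> is multiplied into \<open>\<Phi>\<close> and taken out again
  by \<open>c\<close>.\<close>

lemma problem_A_unique:
  assumes k: "k \<ge> 1" and \<alpha>: "1 < \<alpha>" "\<alpha> < 2" and m: "m < real k"
    and su: "solves_problem_A k \<alpha> m \<phi> \<psi> u" and sv: "solves_problem_A k \<alpha> m \<phi> \<psi> v"
    and x: "x \<in> {0<..<1}" and y: "y \<in> {0<..<1}"
  shows "u x y = v x y"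
proof -
  obtain Du Vu wu wux wuy where
      Du: "\<forall>x\<in>{0<..<1}. \<forall>y\<in>{0..1}. has_RL_deriv \<alpha> (\<lambda>t. u t y) x (Du x y)"
      "continuous_on ({0<..<1} \<times> {0..1}) (\<lambda>(x, y). Du x y)"
    and Vu: "\<forall>x\<in>{0<..<1}. \<forall>y\<in>{0..1}. has_nth_deriv (2 * k) (u x) {0..1} y (Vu x y)"
      "continuous_on ({0<..<1} \<times> {0..1}) (\<lambda>(x, y). Vu x y)"
    and eu: "\<forall>x\<in>{0<..<1}. \<forall>y\<in>{0<..<1}. (- 1) ^ (k + 1) * Du x y - y powr m * Vu x y = 0"
    and wuc: "continuous_on ({0..1} \<times> {0..1}) (\<lambda>(x, y). wu x y)"
      "continuous_on ({0..1} \<times> {0..1}) (\<lambda>(x, y). wux x y)"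
    and wud: "\<forall>x\<in>{0..1}. \<forall>y\<in>{0..1}.
       ((\<lambda>t. wu t y) has_real_derivative wux x y) (at x within {0..1}) \<and>
       ((\<lambda>t. wu x t) has_real_derivative wuy x y) (at y within {0..1})"
    and wu: "\<forall>x\<in>{0<..1}. \<forall>y\<in>{0..1}. wu x y = x powr (2 - \<alpha>) * u x y"
    and bu: "\<forall>x\<in>{0<..1}. \<forall>s<k. has_nth_deriv s (u x) {0..1} 0 0 \<and> has_nth_deriv s (u x) {0..1} 1 0"
    and iu: "\<forall>y\<in>{0..1}. ((\<lambda>x. x powr (2 - \<alpha>) * u x y) \<longlongrightarrow> \<psi> y) (at_right 0) \<and>
       ((\<lambda>x. deriv (\<lambda>t. t powr (2 - \<alpha>) * u t y) x) \<longlongrightarrow> \<phi> y) (at_right 0)"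
    by (rule solves_problem_A_elim[OF su])
  note Du = Du[rule_format] and Vu = Vu[rule_format] and eu = eu[rule_format] and wu = wu[rule_format]
    and wud = wud[rule_format, THEN conjunct1] and bu = bu[rule_format]
    and iu = iu[rule_format, THEN conjunct1] iu[rule_format, THEN conjunct2]
  obtain Dv Vv wv wvx wvy where
      Dv: "\<forall>x\<in>{0<..<1}. \<forall>y\<in>{0..1}. has_RL_deriv \<alpha> (\<lambda>t. v t y) x (Dv x y)"
      "continuous_on ({0<..<1} \<times> {0..1}) (\<lambda>(x, y). Dv x y)"
    and Vv: "\<forall>x\<in>{0<..<1}. \<forall>y\<in>{0..1}. has_nth_deriv (2 * k) (v x) {0..1} y (Vv x y)"
      "continuous_on ({0<..<1} \<times> {0..1}) (\<lambda>(x, y). Vv x y)"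
    and ev: "\<forall>x\<in>{0<..<1}. \<forall>y\<in>{0<..<1}. (- 1) ^ (k + 1) * Dv x y - y powr m * Vv x y = 0"
    and wvc: "continuous_on ({0..1} \<times> {0..1}) (\<lambda>(x, y). wv x y)"
      "continuous_on ({0..1} \<times> {0..1}) (\<lambda>(x, y). wvx x y)"
    and wvd: "\<forall>x\<in>{0..1}. \<forall>y\<in>{0..1}.
       ((\<lambda>t. wv t y) has_real_derivative wvx x y) (at x within {0..1}) \<and>
       ((\<lambda>t. wv x t) has_real_derivative wvy x y) (at y within {0..1})"
    and wv: "\<forall>x\<in>{0<..1}. \<forall>y\<in>{0..1}. wv x y = x powr (2 - \<alpha>) * v x y"
    and bv: "\<forall>x\<in>{0<..1}. \<forall>s<k. has_nth_deriv s (v x) {0..1} 0 0 \<and> has_nth_deriv s (v x) {0..1} 1 0"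
    and iv: "\<forall>y\<in>{0..1}. ((\<lambda>x. x powr (2 - \<alpha>) * v x y) \<longlongrightarrow> \<psi> y) (at_right 0) \<and>
       ((\<lambda>x. deriv (\<lambda>t. t powr (2 - \<alpha>) * v t y) x) \<longlongrightarrow> \<phi> y) (at_right 0)"
    by (rule solves_problem_A_elim[OF sv])
  note Dv = Dv[rule_format] and Vv = Vv[rule_format] and ev = ev[rule_format] and wv = wv[rule_format]
    and wvd = wvd[rule_format, THEN conjunct1] and bv = bv[rule_format]
    and iv = iv[rule_format, THEN conjunct1] iv[rule_format, THEN conjunct2]
  have tu: "wu 0 y = \<psi> y" "wux 0 y = \<phi> y" if "y \<in> {0..1}" for y
    by (rule weighted_trace_data[OF wuc wud wu that iu[OF that]]; assumption)+
  have tv: "wv 0 y = \<psi> y" "wvx 0 y = \<phi> y" if "y \<in> {0..1}" for y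
    by (rule weighted_trace_data[OF wvc wvd wv that iv[OF that]]; assumption)+
  define w where "w x y = wu x y - wv x y" for x y
  define \<Gamma> where "\<Gamma> = Gamma (2 - \<alpha>)"
  have \<Gamma>: "0 < \<Gamma>" using \<alpha> by (simp add: \<Gamma>_def Gamma_real_pos)
  have cdiff: "continuous_on S (\<lambda>(x, y). f x y - g x y)"
    if "continuous_on S (\<lambda>(x, y). f x y)" "continuous_on S (\<lambda>(x, y). g x y)"
    for f g :: "real \<Rightarrow> real \<Rightarrow> real" and S
    using continuous_on_diff[OF that] by (simp add: case_prod_beta')
  have wd: "x powr (\<alpha> - 2) * w x y = u x y - v x y" if "x \<in> {0<..1}" "y \<in> {0..1}" for x y
  proof -
    have "x powr (\<alpha> - 2) * x powr (2 - \<alpha>) = 1" using that by (simp flip: powr_add)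
    moreover have "w x y = x powr (2 - \<alpha>) * (u x y - v x y)"
      using wu[OF that] wv[OF that] by (simp add: w_def algebra_simps)
    ultimately show ?thesis by (simp add: mult.assoc[symmetric])
  qed
  have slice: "has_nth_deriv s (\<lambda>y. x powr (\<alpha> - 2) * w x y) {0..1} y (a - b)"
    if "has_nth_deriv s (u x) {0..1} y a" "has_nth_deriv s (v x) {0..1} y b" "x \<in> {0<..1}" "y \<in> {0..1}" for s x y a b
    by (rule has_nth_deriv_cong[OF has_nth_deriv_diff[OF that(1,2)]])
      (use that wd in \<open>auto intro!: always_eventually\<close>)
  have "w x y = 0"
  proof (rule weighted_solution_eq_zero[OF k \<alpha> m, where w = w and ?x0.0 = x and ?y0.0 = y and c = "1 / \<Gamma>" and wx = "\<lambda>x y. wux x y - wvx x y"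
      and \<Phi> = "\<lambda>x y. \<Gamma> * (Du x y - Dv x y)" and V = "\<lambda>x y. Vu x y - Vv x y"])
    show "0 < 1 / \<Gamma>" using \<Gamma> by simp
    show "continuous_on ({0..1} \<times> {0..1}) (\<lambda>(x, y). w x y)"
      unfolding w_def by (rule cdiff[OF wuc(1) wvc(1)])
    show "continuous_on ({0..1} \<times> {0..1}) (\<lambda>(x, y). wux x y - wvx x y)"
      by (rule cdiff[OF wuc(2) wvc(2)])
    show "((\<lambda>t. w t y) has_real_derivative wux x y - wvx x y) (at x within {0..1})"
      if "x \<in> {0..1}" "y \<in> {0..1}" for x y
      unfolding w_def by (intro DERIV_diff wud wvd that)
    show "w 0 y = 0" "wux 0 y - wvx 0 y = 0" if "y \<in> {0..1}" for y
      using tu[OF that] tv[OF that] by (simp_all add: w_def)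
    show "continuous_on ({0<..<1} \<times> {0..1}) (\<lambda>(x, y). \<Gamma> * (Du x y - Dv x y))"
      using continuous_on_mult[OF continuous_on_const[of _ \<Gamma>] cdiff[OF Du(2) Dv(2)]]
      by (simp add: case_prod_beta')
    show "continuous_on {0..1} (\<lambda>y. Vu x y - Vv x y)" if "x \<in> {0<..<1}" for x
      by (intro continuous_on_diff continuous_on_slice[OF Vu(2)] continuous_on_slice[OF Vv(2)] that)
    show "has_nth_deriv (2 * k) (\<lambda>y. x powr (\<alpha> - 2) * w x y) {0..1} y (Vu x y - Vv x y)"
      if "x \<in> {0<..<1}" "y \<in> {0..1}" for x y
      by (rule slice[OF Vu(1) Vv(1)]) (use that in auto)
    show "has_nth_deriv s (\<lambda>y. x powr (\<alpha> - 2) * w x y) {0..1} 0 0 \<and>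
        has_nth_deriv s (\<lambda>y. x powr (\<alpha> - 2) * w x y) {0..1} 1 0"
      if "x \<in> {0<..<1}" "s < k" for x s
      using slice[of s x 0 0 0] slice[of s x 1 0 0] bu[of x s] bv[of x s] that by simp
    show "(- 1) ^ (k + 1) * (1 / \<Gamma> * (\<Gamma> * (Du x y - Dv x y))) = y powr m * (Vu x y - Vv x y)"
      if "x \<in> {0<..<1}" "y \<in> {0<..<1}" for x y
      using eu[OF that] ev[OF that] \<Gamma> by (simp add: algebra_simps)
    show "has_nth_deriv 2 (\<lambda>t. integral {0..t} (\<lambda>\<tau>. (t - \<tau>) powr (1 - \<alpha>) * (\<tau> powr (\<alpha> - 2) * w \<tau> y))) UNIV x
        (\<Gamma> * (Du x y - Dv x y))" if x: "x \<in> {0<..<1}" and y: "y \<in> {0..1}" for x y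
    proof -
      let ?I = "\<lambda>u t. integral {0..t} (\<lambda>\<tau>. u \<tau> y / (t - \<tau>) powr (\<alpha> - 1))"
      have "has_nth_deriv 2 (?I u) UNIV x (\<Gamma> * Du x y)" "has_nth_deriv 2 (?I v) UNIV x (\<Gamma> * Dv x y)"
        using Du(1)[OF x y] Dv(1)[OF x y] \<Gamma> by (auto simp: has_RL_deriv_def \<Gamma>_def)
      from has_nth_deriv_diff[OF this]
      have "has_nth_deriv 2 (\<lambda>t. ?I u t - ?I v t) UNIV x (\<Gamma> * (Du x y - Dv x y))"
        by (simp only: right_diff_distrib)
      then show ?thesis
      proof (rule has_nth_deriv_cong)
        \<comment> \<open>The two forms of the integral are compared only for \<open>t\<close> in
          \<open>(0, 1)\<close>; a neighbourhood of \<open>x\<close> determines the second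
          derivative.\<close>
        have "\<forall>\<^sub>F t in nhds x. t \<in> {0<..<1}"
          using x by (intro eventually_nhds_in_open) auto
        then show "\<forall>\<^sub>F t in nhds x. t \<in> UNIV \<longrightarrow> ?I u t - ?I v t =
            integral {0..t} (\<lambda>\<tau>. (t - \<tau>) powr (1 - \<alpha>) * (\<tau> powr (\<alpha> - 2) * w \<tau> y))"
        proof eventually_elim
          fix t :: real assume t: "t \<in> {0<..<1}"
          from has_integral_diff[OF RL_integral_eq[OF \<alpha> wuc(1) wu y t] RL_integral_eq[OF \<alpha> wvc(1) wv y t]]
          show "t \<in> UNIV \<longrightarrow> ?I u t - ?I v t =
            integral {0..t} (\<lambda>\<tau>. (t - \<tau>) powr (1 - \<alpha>) * (\<tau> powr (\<alpha> - 2) * w \<tau> y))"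
            by (simp add: w_def right_diff_distrib integral_unique)
        qed
      qed simp
    qed
    show "x \<in> {0<..<1}" "y \<in> {0..1}" using x y by auto
  qed
  then show ?thesis using wd[of x y] x y by simp
qed

lemma has_nth_deriv_zero: "has_nth_deriv n (\<lambda>_. 0) S x 0"
  by (induction n arbitrary: x) (auto intro!: exI[of _ "\<lambda>_. 0"])

text \<open>Supplies the comparison solution that turns uniqueness into the vanishing of solutions
  with zero data.\<close>

lemma solves_problem_A_zero: "solves_problem_A k \<alpha> m (\<lambda>_. 0) (\<lambda>_. 0) (\<lambda>_ _. 0)"
proof -
  have "C1_closed_square (\<lambda>_ _. 0)"
    unfolding C1_closed_square_def by (intro conjI exI[of _ "\<lambda>_ _. 0"]) auto
  then show ?thesis
    unfolding solves_problem_A_def has_RL_deriv_def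
    by (intro conjI exI[of _ "\<lambda>_ _. 0"]) (auto simp: has_nth_deriv_zero intro!: exI[of _ "0::real"])
qed

theorem mainTheorem2:
  fixes k :: nat and \<alpha> m :: real
  assumes "k \<ge> 1" and "1 < \<alpha>" and "\<alpha> < 2"
    and "0 \<le> m" and "m < real k" and "m \<notin> real ` {1..}"
  shows "(\<forall>\<phi> \<psi> u v. solves_problem_A k \<alpha> m \<phi> \<psi> u \<and> solves_problem_A k \<alpha> m \<phi> \<psi> v \<longrightarrow>
            (\<forall>x\<in>{0<..<1}. \<forall>y\<in>{0<..<1}. u x y = v x y))
       \<and> (\<forall>u. solves_problem_A k \<alpha> m (\<lambda>_. 0) (\<lambda>_. 0) u \<longrightarrow>
            (\<forall>x\<in>{0<..<1}. \<forall>y\<in>{0<..<1}. u x y = 0))"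
proof (intro conjI allI impI ballI)
  fix \<phi> \<psi> u v and x y :: real
  assume h: "solves_problem_A k \<alpha> m \<phi> \<psi> u \<and> solves_problem_A k \<alpha> m \<phi> \<psi> v"
    and "x \<in> {0<..<1}" "y \<in> {0<..<1}"
  then show "u x y = v x y"
    by (intro problem_A_unique[OF assms(1-3,5) h[THEN conjunct1] h[THEN conjunct2]])
next
  fix u and x y :: real
  assume h: "solves_problem_A k \<alpha> m (\<lambda>_. 0) (\<lambda>_. 0) u"
    and "x \<in> {0<..<1}" "y \<in> {0<..<1}"
  then show "u x y = 0"
    by (intro problem_A_unique[OF assms(1-3,5) h solves_problem_A_zero])
qed

end
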